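(* Let $\mathcal{X}$ be a complete and separable metric space and let $\mathcal{Y}\subseteq\mathbb{R}$ be closed. Let $\mathrm{P}_1,\mathrm{P}_2\in\mathcal{M}_1(\mathcal{X}\times\mathcal{Y})$ be probability measures. Let $\mathcal{X}_1,\dots,\mathcal{X}_B\subseteq\mathcal{X}$ be Borel sets (not necessarily disjoint) with $\mathcal{X}=\bigcup_{b=1}^B\mathcal{X}_b$ and $\mathrm{P}_i(\mathcal{X}_b\times\mathcal{Y})>0$ for all $b\in\{1,\dots,B\}$ and $i\in\{1,2\}$. For all $i\in\{1,2\}$ and $b\in\{1,\dots,B\}$, let $\lambda_{i,b}>0$ and let $k_{i,b}$ be a bounded and measurable kernel on $\mathcal{X}_b$ with separable RKHS $H_{i,b}$. Put $\kappa_b:=\max\{\|k_{1,b}\|_\infty,\|k_{2,b}\|_\infty\}$ and $\tau_b:=\min\{\lambda_{1,b},\lambda_{2,b}\}$ for all $b$. Let $L$ be a convex and Lipschitz continuous loss function with Lipschitz constant $|L|_1$. Let $w_1,\dots,w_B$ be weight functions satisfying (W1) $w_b:\mathcal{X}\to[0,1]$ for all $b\in\{1,\dots,B\}$; (W2) $\sum_{b=1}^Bw_b(x)=1$ for all $x\in\mathcal{X}$; (W3) $w_b(x)=0$ for all $x\notin\mathcal{X}_b$ and all $b\in\{1,\dots,B\}$. For $i=1,2$ let the localized SVM $f_{\mathrm{P}_i,\boldsymbol{\lambda_i},\boldsymbol{k_i}}:\mathcal{X}\to\mathbb{R}$ be defined by $$f_{\mathrm{P}_i,\boldsymbol{\lambda_i},\boldsymbol{k_i}}(x):=\sum_{b=1}^Bw_b(x)\cdot\hat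 f_{\mathrm{P}_{i,b},\lambda_{i,b},k_{i,b}}(x),$$ where $\mathrm{P}_{i,b}$ is the local probability measure of $\mathrm{P}_i$ on $\mathcal{X}_b\times\mathcal{Y}$ and $\hat f$ denotes the zero-extension to $\mathcal{X}$ of the local SVM $f_{\mathrm{P}_{i,b},\lambda_{i,b},k_{i,b}}:\mathcal{X}_b\to\mathbb{R}$. Then $$\|f_{\mathrm{P}_1,\boldsymbol{\lambda_1},\boldsymbol{k_1}}-f_{\mathrm{P}_2,\boldsymbol{\lambda_2},\boldsymbol{k_2}}\|_\infty\le|L|_1\cdot\max_{b\in\{1,\dots,B\}}\frac1{\tau_b}\cdot\left(\kappa_b^2\cdot\|\mathrm{P}_{1,b}-\mathrm{P}_{2,b}\|_{tv}+\frac{\kappa_b^2}{\tau_b}\cdot|\lambda_{1,b}-\lambda_{2,b}|+\frac12\cdot\|k_{1,b}-k_{2,b}\|_\infty+\kappa_b\cdot\sqrt{\|k_{1,b}-k_{2,b}\|_\infty}\right).$$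
   Context: All spaces carry their Borel $\sigma$-algebras; $\mathcal{M}_1(\mathcal{X}\times\mathcal{Y})$ is the set of Borel probability measures on $\mathcal{X}\times\mathcal{Y}$. A kernel on a set $S$ is a symmetric positive semidefinite function $k:S\times S\to\mathbb{R}$; its reproducing kernel Hilbert space is abbreviated RKHS. For a kernel $k$, $\|k\|_\infty:=\sup_{x}\sqrt{k(x,x)}$, and $k$ is bounded if this is finite. For the difference of two kernels (generally not a kernel), $\|k_1-k_2\|_\infty:=\sup_{x,x'}|k_1(x,x')-k_2(x,x')|$; for a function $f$, $\|f\|_\infty:=\sup_x|f(x)|$. A loss function is a measurable function $L:\mathcal{X}\times\mathcal{Y}\times\mathbb{R}\to[0,\infty)$. It is convex if $L(x,y,\cdot)$ is convex for all $(x,y)$, and Lipschitz continuous if there is $c\ge0$ with $|L(x,y,t_1)-L(x,y,t_2)|\le c|t_1-t_2|$ for all $x,y,t_1,t_2$; the smallest such $c$ is $|L|_1$. The shifted loss function is $L^\star(x,y,t):=L(x,y,t)-L(x,y,0)$. For a Borel set $\tilde{\mathcal{X}}\subseteq\mathcal{X}$, a Borel probability measure $\mathrm{Q}$ on $\tilde{\mathcal{X}}\times\mathcal{Y}$, $\lambda>0$ and a bounded measurable kernel $k$ on $\tilde{\mathcal{X}}$ with separable RKHS $H$, the support vector machine (SVM) is the (existing and unique) minimizer $$f_{\mathrm{Q},\lambda,k}:=\arg\inf_{f\in H}\ \mathbb{E}_{\mathrm{Q}}[L^\star(X,Y,f(X))]+\lambda\|f\|_H^2,\qquad f_{\mathrm{Q},\lambda,k}:\tilde{\mathcal{X}}\to\mathbb{R}$$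 (the loss $L$ is fixed and omitted from the notation). Local probability measures: if $\mathrm{P}(\tilde{\mathcal{X}}\times\mathcal{Y})>0$, then $\mathrm{P}_{\tilde{\mathcal{X}}}:=\frac{1}{\mathrm{P}(\tilde{\mathcal{X}}\times\mathcal{Y})}\mathrm{P}|_{\tilde{\mathcal{X}}\times\mathcal{Y}}$; write $\mathrm{P}_{i,b}:=(\mathrm{P}_i)_{\mathcal{X}_b}$. Zero-extension: for $g:\tilde{\mathcal{X}}\to\mathbb{R}$, $\hat g:\mathcal{X}\to\mathbb{R}$ equals $g$ on $\tilde{\mathcal{X}}$ and $0$ elsewhere. Vectors: $\boldsymbol{\lambda_i}=(\lambda_{i,1},\dots,\lambda_{i,B})$, $\boldsymbol{k_i}=(k_{i,1},\dots,k_{i,B})$. For a finite signed measure $\nu$, $\|\nu\|_{tv}:=\sup\{\sum_{i=1}^n|\nu(E_i)|: E_1,\dots,E_n \text{ a finite measurable partition of the whole space}\}$. *)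

theory Defs
  imports "HOL-Probability.Probability"
begin

text \<open>A real-valued function on \<open>S\<close> is represented by a member of \<^term>\<open>extensional S\<close>;
  a space of such functions is given by its carrier \<open>H\<close> and its inner product \<open>ip\<close>.\<close>

definition fs_norm :: "(('a \<Rightarrow> real) \<Rightarrow> ('a \<Rightarrow> real) \<Rightarrow> real) \<Rightarrow> ('a \<Rightarrow> real) \<Rightarrow> real" where
  "fs_norm ip f = sqrt (ip f f)"

text \<open>The value \<open>0\<close> off the carrier is irrelevant, but \<^locale>\<open>Metric_space\<close> asks for
  nonnegativity and symmetry of the distance on the whole type.\<close>

definition fs_dist :: "'a set \<Rightarrow> ('a \<Rightarrow> real) set \<Rightarrow> (('a \<Rightarrow> real) \<Rightarrow> ('a \<Rightarrow> real) \<Rightarrow> real)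
    \<Rightarrow> ('a \<Rightarrow> real) \<Rightarrow> ('a \<Rightarrow> real) \<Rightarrow> real" where
  "fs_dist S H ip f g =
    (if f \<in> H \<and> g \<in> H then fs_norm ip (\<lambda>x\<in>S. f x - g x) else 0)"

locale inner_product_function_space =
  fixes S :: "'a set"
    and H :: "('a \<Rightarrow> real) set"
    and ip :: "('a \<Rightarrow> real) \<Rightarrow> ('a \<Rightarrow> real) \<Rightarrow> real"
  assumes carrier_extensional: "H \<subseteq> extensional S"
    and zero_closed: "(\<lambda>x\<in>S. 0) \<in> H"
    and add_closed: "\<lbrakk>f \<in> H; g \<in> H\<rbrakk> \<Longrightarrow> (\<lambda>x\<in>S. f x + g x) \<in> H"
    and scale_closed: "f \<in> H \<Longrightarrow> (\<lambda>x\<in>S. c * f x) \<in> H"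
    and ip_commute: "\<lbrakk>f \<in> H; g \<in> H\<rbrakk> \<Longrightarrow> ip f g = ip g f"
    and ip_add_left: "\<lbrakk>f \<in> H; g \<in> H; h \<in> H\<rbrakk> \<Longrightarrow> ip (\<lambda>x\<in>S. f x + g x) h = ip f h + ip g h"
    and ip_scale_left: "\<lbrakk>f \<in> H; h \<in> H\<rbrakk> \<Longrightarrow> ip (\<lambda>x\<in>S. c * f x) h = c * ip f h"
    and ip_nonneg: "f \<in> H \<Longrightarrow> 0 \<le> ip f f"
    and ip_eq_zeroD: "\<lbrakk>f \<in> H; ip f f = 0\<rbrakk> \<Longrightarrow> f = (\<lambda>x\<in>S. 0)"
begin

lemma ip_add_scale:
  assumes "f \<in> H" "g \<in> H"
  shows "ip (\<lambda>x\<in>S. f x + c * g x) (\<lambda>x\<in>S. f x + c * g x) = ip f f + 2 * c * ip f g + c\<^sup>2 * ip g g"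
proof -
  let ?cg = "\<lambda>x\<in>S. c * g x"
  have eq: "(\<lambda>x\<in>S. f x + c * g x) = (\<lambda>x\<in>S. f x + ?cg x)" by (auto simp: restrict_def)
  have cg: "?cg \<in> H" using assms scale_closed by blast
  have s: "(\<lambda>x\<in>S. f x + ?cg x) \<in> H" using assms cg add_closed by blast
  have l: "ip (\<lambda>x\<in>S. f x + ?cg x) h = ip f h + c * ip g h" if "h \<in> H" for h
    using ip_add_left[OF assms(1) cg that] ip_scale_left[OF assms(2) that] by simp
  have "ip f (\<lambda>x\<in>S. f x + ?cg x) = ip f f + c * ip g f"
    using ip_commute[OF assms(1) s] l[OF assms(1)] by simp
  moreover have "ip g (\<lambda>x\<in>S. f x + ?cg x) = ip f g + c * ip g g"
    using ip_commute[OF assms(2) s] l[OF assms(2)] by simp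
  ultimately have "ip (\<lambda>x\<in>S. f x + ?cg x) (\<lambda>x\<in>S. f x + ?cg x)
      = ip f f + c * ip g f + c * (ip f g + c * ip g g)"
    using l[OF s] by simp
  then show ?thesis unfolding eq
    using ip_commute[OF assms] by (simp add: algebra_simps power2_eq_square)
qed

lemma cauchy_schwarz:
  assumes "f \<in> H" "g \<in> H"
  shows "(ip f g)\<^sup>2 \<le> ip f f * ip g g"
proof (cases "ip g g = 0")
  case True
  then have "g = (\<lambda>x\<in>S. 0 * g x)" using ip_eq_zeroD[OF assms(2)] by (simp add: restrict_def)
  then have "ip g f = 0" using ip_scale_left[OF assms(2,1), of 0] by simp
  then show ?thesis using ip_commute[OF assms] ip_nonneg assms by simp
next
  case False
  then have pos: "ip g g > 0" using ip_nonneg[OF assms(2)] by simp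
  define c where "c = - ip f g / ip g g"
  have eq: "(\<lambda>x\<in>S. f x + c * g x) = (\<lambda>x\<in>S. f x + (\<lambda>x\<in>S. c * g x) x)"
    by (auto simp: restrict_def)
  have "(\<lambda>x\<in>S. f x + c * g x) \<in> H" unfolding eq using assms add_closed scale_closed by blast
  from ip_nonneg[OF this] have "0 \<le> ip f f + 2 * c * ip f g + c\<^sup>2 * ip g g"
    using ip_add_scale[OF assms] by simp
  also have "\<dots> = ip f f - (ip f g)\<^sup>2 / ip g g"
    using pos by (simp add: c_def field_simps power2_eq_square)
  finally show ?thesis using pos by (simp add: field_simps)
qed

lemma fs_norm_triangle:
  assumes "f \<in> H" "g \<in> H"
  shows "fs_norm ip (\<lambda>x\<in>S. f x + g x) \<le> fs_norm ip f + fs_norm ip g"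
proof -
  have "ip f g \<le> sqrt (ip f f * ip g g)"
    using cauchy_schwarz[OF assms] by (rule real_le_rsqrt)
  then have "ip f f + 2 * ip f g + ip g g \<le> (sqrt (ip f f) + sqrt (ip g g))\<^sup>2"
    using ip_nonneg assms by (simp add: power2_sum real_sqrt_mult)
  then show ?thesis
    using ip_add_scale[OF assms, of 1] ip_nonneg assms
    by (auto simp: fs_norm_def intro: real_le_lsqrt)
qed

lemma diff_closed:
  assumes "f \<in> H" "g \<in> H"
  shows "(\<lambda>x\<in>S. f x - g x) \<in> H"
proof -
  have "(\<lambda>x\<in>S. f x - g x) = (\<lambda>x\<in>S. f x + (\<lambda>x\<in>S. -1 * g x) x)" by (auto simp: restrict_def)
  then show ?thesis using add_closed[OF assms(1) scale_closed[OF assms(2), of "-1"]] by simp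
qed

lemma Metric_space_fs_dist: "Metric_space H (fs_dist S H ip)"
proof
  show "0 \<le> fs_dist S H ip f g" for f g
    using ip_nonneg diff_closed by (auto simp: fs_dist_def fs_norm_def)
  have sym: "ip (\<lambda>x\<in>S. f x - g x) (\<lambda>x\<in>S. f x - g x) = ip (\<lambda>x\<in>S. g x - f x) (\<lambda>x\<in>S. g x - f x)"
    if "f \<in> H" "g \<in> H" for f g
  proof -
    let ?d = "\<lambda>x\<in>S. f x - g x"
    have d: "?d \<in> H" using that diff_closed by blast
    have e: "(\<lambda>x\<in>S. g x - f x) = (\<lambda>x\<in>S. -1 * ?d x)" by (auto simp: restrict_def)
    have "ip ?d (\<lambda>x\<in>S. -1 * ?d x) = - ip ?d ?d"
      using ip_commute[OF d scale_closed[OF d, of "-1"]] ip_scale_left[OF d d, of "-1"] by simp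
    then show ?thesis unfolding e
      using ip_scale_left[OF d scale_closed[OF d, of "-1"], of "-1"] by simp
  qed
  show "fs_dist S H ip f g = fs_dist S H ip g f" for f g
    using sym by (auto simp: fs_dist_def fs_norm_def)
  show "fs_dist S H ip f g = 0 \<longleftrightarrow> f = g" if "f \<in> H" "g \<in> H" for f g
  proof
    assume "fs_dist S H ip f g = 0"
    then have z: "(\<lambda>x\<in>S. f x - g x) = (\<lambda>x\<in>S. 0)"
      using that diff_closed[OF that] ip_eq_zeroD by (simp add: fs_dist_def fs_norm_def)
    have "f x = g x" if "x \<in> S" for x
      using fun_cong[OF z, of x] that by simp
    then show "f = g" using that carrier_extensional by (intro extensionalityI[of f S g]) auto
  next
    assume "f = g"
    have "ip (\<lambda>x\<in>S. 0) (\<lambda>x\<in>S. 0) = 0"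
      using ip_scale_left[OF zero_closed zero_closed, of 0] by simp
    then show "fs_dist S H ip f g = 0" using \<open>f = g\<close> by (simp add: fs_dist_def fs_norm_def)
  qed
  show "fs_dist S H ip f h \<le> fs_dist S H ip f g + fs_dist S H ip g h"
    if "f \<in> H" "g \<in> H" "h \<in> H" for f g h
  proof -
    have "(\<lambda>x\<in>S. f x - h x) = (\<lambda>x\<in>S. (\<lambda>x\<in>S. f x - g x) x + (\<lambda>x\<in>S. g x - h x) x)"
      by (auto simp: restrict_def)
    then show ?thesis
      using that fs_norm_triangle[OF diff_closed[OF that(1,2)] diff_closed[OF that(2,3)]]
      by (simp add: fs_dist_def)
  qed
qed

end

locale hilbert_function_space = inner_product_function_space +
  assumes complete: "Metric_space.mcomplete H (fs_dist S H ip)"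

definition separable_fs :: "'a set \<Rightarrow> ('a \<Rightarrow> real) set
    \<Rightarrow> (('a \<Rightarrow> real) \<Rightarrow> ('a \<Rightarrow> real) \<Rightarrow> real) \<Rightarrow> bool" where
  "separable_fs S H ip \<longleftrightarrow> separable_space (Metric_space.mtopology H (fs_dist S H ip))"

definition is_kernel :: "'a set \<Rightarrow> ('a \<Rightarrow> 'a \<Rightarrow> real) \<Rightarrow> bool" where
  "is_kernel S k \<longleftrightarrow>
    (\<forall>x\<in>S. \<forall>x'\<in>S. k x x' = k x' x) \<and>
    (\<forall>n (c :: nat \<Rightarrow> real) (p :: nat \<Rightarrow> 'a). (\<forall>i<n. p i \<in> S) \<longrightarrow>
      0 \<le> (\<Sum>i<n. \<Sum>j<n. c i * c j * k (p i) (p j)))"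

definition measurable_kernel :: "'a::topological_space set \<Rightarrow> ('a \<Rightarrow> 'a \<Rightarrow> real) \<Rightarrow> bool" where
  "measurable_kernel S k \<longleftrightarrow>
    (\<lambda>(x, x'). k x x') \<in> borel_measurable (restrict_space borel (S \<times> S))"

definition bounded_kernel :: "'a set \<Rightarrow> ('a \<Rightarrow> 'a \<Rightarrow> real) \<Rightarrow> bool" where
  "bounded_kernel S k \<longleftrightarrow> bdd_above ((\<lambda>x. sqrt (k x x)) ` S)"

text \<open>The next two suprema are taken in the reals, hence meaningful only for bounded kernels
  on nonempty \<open>S\<close>.\<close>

definition kernel_sup :: "'a set \<Rightarrow> ('a \<Rightarrow> 'a \<Rightarrow> real) \<Rightarrow> real" where
  "kernel_sup S k = (SUP x\<in>S. sqrt (k x x))"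

definition kernel_diff_sup :: "'a set \<Rightarrow> ('a \<Rightarrow> 'a \<Rightarrow> real) \<Rightarrow> ('a \<Rightarrow> 'a \<Rightarrow> real) \<Rightarrow> real" where
  "kernel_diff_sup S k1 k2 = (SUP (x, x')\<in>S \<times> S. \<bar>k1 x x' - k2 x x'\<bar>)"

text \<open>By the Moore--Aronszajn theorem every kernel \<open>k\<close> on \<open>S\<close> has exactly one such space:
  the carrier and the values of \<open>ip\<close> on it are determined by \<open>S\<close> and \<open>k\<close>.\<close>

locale rkhs = hilbert_function_space S H ip
  for S :: "'a set" and k :: "'a \<Rightarrow> 'a \<Rightarrow> real"
    and H :: "('a \<Rightarrow> real) set" and ip :: "('a \<Rightarrow> real) \<Rightarrow> ('a \<Rightarrow> real) \<Rightarrow> real" +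
  assumes kernel_section: "x \<in> S \<Longrightarrow> (\<lambda>x'\<in>S. k x' x) \<in> H"
    and reproducing: "\<lbrakk>f \<in> H; x \<in> S\<rbrakk> \<Longrightarrow> f x = ip f (\<lambda>x'\<in>S. k x' x)"

definition loss_function :: "real set \<Rightarrow> ('a::topological_space \<Rightarrow> real \<Rightarrow> real \<Rightarrow> real) \<Rightarrow> bool" where
  "loss_function Y L \<longleftrightarrow>
    (\<lambda>(x, y, t). L x y t) \<in> borel_measurable (restrict_space borel (UNIV \<times> Y \<times> UNIV)) \<and>
    (\<forall>x. \<forall>y\<in>Y. \<forall>t. 0 \<le> L x y t)"

definition convex_loss :: "real set \<Rightarrow> ('a \<Rightarrow> real \<Rightarrow> real \<Rightarrow> real) \<Rightarrow> bool" where
  "convex_loss Y L \<longleftrightarrow> (\<forall>x. \<forall>y\<in>Y. convex_on UNIV (L x y))"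

definition is_lipschitz_const :: "real set \<Rightarrow> ('a \<Rightarrow> real \<Rightarrow> real \<Rightarrow> real) \<Rightarrow> real \<Rightarrow> bool" where
  "is_lipschitz_const Y L c \<longleftrightarrow>
    0 \<le> c \<and> (\<forall>x. \<forall>y\<in>Y. \<forall>t1 t2. \<bar>L x y t1 - L x y t2\<bar> \<le> c * \<bar>t1 - t2\<bar>)"

definition lipschitz_loss :: "real set \<Rightarrow> ('a \<Rightarrow> real \<Rightarrow> real \<Rightarrow> real) \<Rightarrow> bool" where
  "lipschitz_loss Y L \<longleftrightarrow> (\<exists>c. is_lipschitz_const Y L c)"

definition loss_lip :: "real set \<Rightarrow> ('a \<Rightarrow> real \<Rightarrow> real \<Rightarrow> real) \<Rightarrow> real" where
  "loss_lip Y L = (LEAST c. is_lipschitz_const Y L c)"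

definition shifted_loss :: "('a \<Rightarrow> real \<Rightarrow> real \<Rightarrow> real) \<Rightarrow> 'a \<Rightarrow> real \<Rightarrow> real \<Rightarrow> real" where
  "shifted_loss L x y t = L x y t - L x y 0"

definition svm_objective :: "('a \<Rightarrow> real \<Rightarrow> real \<Rightarrow> real) \<Rightarrow> ('a \<times> real) measure \<Rightarrow> real
    \<Rightarrow> (('a \<Rightarrow> real) \<Rightarrow> ('a \<Rightarrow> real) \<Rightarrow> real) \<Rightarrow> ('a \<Rightarrow> real) \<Rightarrow> real" where
  "svm_objective L Q lam ip f =
    (LINT z|Q. shifted_loss L (fst z) (snd z) (f (fst z))) + lam * (fs_norm ip f)\<^sup>2"

text \<open>The kernel enters only through its RKHS, which is passed explicitly as \<open>H\<close>, \<open>ip\<close>.\<close>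

definition svm :: "('a \<Rightarrow> real \<Rightarrow> real \<Rightarrow> real) \<Rightarrow> ('a \<times> real) measure \<Rightarrow> real
    \<Rightarrow> ('a \<Rightarrow> real) set \<Rightarrow> (('a \<Rightarrow> real) \<Rightarrow> ('a \<Rightarrow> real) \<Rightarrow> real) \<Rightarrow> 'a \<Rightarrow> real" where
  "svm L Q lam H ip = arg_min_on (svm_objective L Q lam ip) H"

definition local_measure :: "('a \<times> real) measure \<Rightarrow> 'a set \<Rightarrow> real set \<Rightarrow> ('a \<times> real) measure" where
  "local_measure P S Y = scale_measure (1 / emeasure P (S \<times> Y)) (restrict_space P (S \<times> Y))"

definition zero_ext :: "'a set \<Rightarrow> ('a \<Rightarrow> real) \<Rightarrow> 'a \<Rightarrow> real" where
  "zero_ext S g x = (if x \<in> S then g x else 0)"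

definition localized_svm :: "nat \<Rightarrow> (nat \<Rightarrow> 'a \<Rightarrow> real) \<Rightarrow> (nat \<Rightarrow> 'a set) \<Rightarrow> real set
    \<Rightarrow> ('a \<Rightarrow> real \<Rightarrow> real \<Rightarrow> real) \<Rightarrow> ('a \<times> real) measure \<Rightarrow> (nat \<Rightarrow> real)
    \<Rightarrow> (nat \<Rightarrow> ('a \<Rightarrow> real) set) \<Rightarrow> (nat \<Rightarrow> ('a \<Rightarrow> real) \<Rightarrow> ('a \<Rightarrow> real) \<Rightarrow> real)
    \<Rightarrow> 'a \<Rightarrow> real" where
  "localized_svm B w X Y L P lam H ip x =
    (\<Sum>b=1..B. w b x * zero_ext (X b) (svm L (local_measure P (X b) Y) (lam b) (H b) (ip b)) x)"

text \<open>Extended-real valued, so that an upper bound also asserts boundedness of the function.\<close>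

definition sup_norm :: "('a \<Rightarrow> real) \<Rightarrow> ereal" where
  "sup_norm f = (SUP x. ereal \<bar>f x\<bar>)"

text \<open>Total variation norm of the finite signed measure given by the set function \<open>\<nu>\<close>
  on the measurable space \<open>M\<close>.\<close>

definition tv_norm :: "'b measure \<Rightarrow> ('b set \<Rightarrow> real) \<Rightarrow> real" where
  "tv_norm M \<nu> = Sup {(\<Sum>i<n. \<bar>\<nu> (E i)\<bar>) | (n::nat) E.
     (\<forall>i<n. E i \<in> sets M) \<and> disjoint_family_on E {..<n} \<and> (\<Union>i<n. E i) = space M}"

definition tv_diff :: "'b measure \<Rightarrow> 'b measure \<Rightarrow> real" where
  "tv_diff P Q = tv_norm P (\<lambda>E. measure P E - measure Q E)"

end

theory Submission
  imports Defs "HOL-Real_Asymp.Real_Asymp"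
begin

text \<open>On each \<open>X b\<close> the measure, the regularization parameter and the kernel are exchanged one
  after the other, passing through intermediate SVMs; the weights then average the local bounds.
  Strong convexity of the objective settles the first two exchanges. For the kernels,
  first-order optimality shows that \<open>f\<^sub>1\<close> is a limit in its RKHS of absolutely convex combinations
  of \<open>c / (2 \<lambda>) k\<^sub>1(\<cdot>, x)\<close>. The same combination \<open>g\<close> of the sections of \<open>k\<^sub>2\<close> is uniformly
  within \<open>c \<delta> / (2 \<lambda>)\<close> of \<open>f\<^sub>1\<close>, and its objective value exceeds that of \<open>f\<^sub>1\<close> by at most
  \<open>3 c\<^sup>2 \<delta> / (4 \<lambda>)\<close>. If \<open>f\<^sub>1\<close> has the smaller of the two optimal values, which may be assumed by
  symmetry, strong convexity makes \<open>g\<close> close to \<open>f\<^sub>2\<close>.\<close>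

section \<open>Reproducing kernel Hilbert spaces\<close>

text \<open>The obstacle in exchanging kernels is that the two minimizers lie in different Hilbert
  spaces, with no inner product between them. What the spaces share is evaluation at points: the
  risk sees only values on \<open>S\<close> and so acts on both carriers, and one choice of points
  and coefficients makes sense for both kernels. The hull is dictated by duality. First-order
  optimality bounds \<open>ip f u\<close> by \<open>c / (2 * lam)\<close> times the supremum of
  \<bar>u\<bar>, so \<open>f\<close> lies in the bipolar of the sections scaled by this constant,
  which is their closed absolutely convex hull. The bound on the coefficient mass is what keeps the
  cost of changing the kernel proportional to \<open>\<delta>\<close>, both in values and in squared
  norms. An objective gap of order \<open>\<delta>\<close> controls the distance in norm only up to
  order \<open>sqrt \<delta>\<close>; this is the origin of the square root in the bound, while its
  linear term is the uniform distance from \<open>f\<^sub>1\<close> to \<open>g\<close>.\<close>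

definition lincomb :: "'a set \<Rightarrow> real \<Rightarrow> ('a \<Rightarrow> real) \<Rightarrow> real \<Rightarrow> ('a \<Rightarrow> real) \<Rightarrow> 'a \<Rightarrow> real" where
  "lincomb S a f b g = (\<lambda>x\<in>S. a * f x + b * g x)"

lemma lincomb_apply [simp]: "x \<in> S \<Longrightarrow> lincomb S a f b g x = a * f x + b * g x"
  by (simp add: lincomb_def)

context inner_product_function_space
begin

lemma lincomb_closed [simp, intro]: "f \<in> H \<Longrightarrow> g \<in> H \<Longrightarrow> lincomb S a f b g \<in> H"
proof -
  assume *: "f \<in> H" "g \<in> H"
  have "lincomb S a f b g = (\<lambda>x\<in>S. (\<lambda>x\<in>S. a * f x) x + (\<lambda>x\<in>S. b * g x) x)"
    by (auto simp: lincomb_def restrict_def)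
  then show ?thesis using * add_closed scale_closed by metis
qed

lemma ip_lincomb_left:
  "f \<in> H \<Longrightarrow> g \<in> H \<Longrightarrow> h \<in> H \<Longrightarrow> ip (lincomb S a f b g) h = a * ip f h + b * ip g h"
proof -
  assume *: "f \<in> H" "g \<in> H" "h \<in> H"
  have "lincomb S a f b g = (\<lambda>x\<in>S. (\<lambda>x\<in>S. a * f x) x + (\<lambda>x\<in>S. b * g x) x)"
    by (auto simp: lincomb_def restrict_def)
  then show ?thesis using * ip_add_left[of "\<lambda>x\<in>S. a * f x" "\<lambda>x\<in>S. b * g x" h]
    by (simp only: scale_closed ip_scale_left)
qed

lemma ip_lincomb_right:
  "f \<in> H \<Longrightarrow> g \<in> H \<Longrightarrow> h \<in> H \<Longrightarrow> ip h (lincomb S a f b g) = a * ip h f + b * ip h g"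
  using ip_lincomb_left[of f g h a b] ip_commute[of h] lincomb_closed[of f g a b] by metis

lemmas ip_lincomb = ip_lincomb_left ip_lincomb_right lincomb_closed

lemma ip_lincomb_self:
  "f \<in> H \<Longrightarrow> g \<in> H \<Longrightarrow> ip (lincomb S a f b g) (lincomb S a f b g)
    = a\<^sup>2 * ip f f + 2 * a * b * ip f g + b\<^sup>2 * ip g g"
  by (simp add: ip_lincomb ip_commute[of g f] algebra_simps power2_eq_square)

lemma H_eqI: "f \<in> H \<Longrightarrow> g \<in> H \<Longrightarrow> (\<And>x. x \<in> S \<Longrightarrow> f x = g x) \<Longrightarrow> f = g"
  using carrier_extensional by (intro extensionalityI[of f S g]) auto

lemma fs_dist_eq: "f \<in> H \<Longrightarrow> g \<in> H \<Longrightarrow> fs_dist S H ip f g = fs_norm ip (lincomb S 1 f (-1) g)"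
  by (simp add: fs_dist_def lincomb_def)

lemma fs_norm_sq: "f \<in> H \<Longrightarrow> (fs_norm ip f)\<^sup>2 = ip f f"
  by (simp add: fs_norm_def ip_nonneg)

lemma fs_norm_nonneg: "f \<in> H \<Longrightarrow> 0 \<le> fs_norm ip f"
  by (simp add: fs_norm_def ip_nonneg)

lemma ip_le_fs_norm: "f \<in> H \<Longrightarrow> g \<in> H \<Longrightarrow> \<bar>ip f g\<bar> \<le> fs_norm ip f * fs_norm ip g"
  using cauchy_schwarz[of f g]
  by (metis fs_norm_def real_sqrt_abs real_sqrt_le_mono real_sqrt_mult)

text \<open>An almost nearest point of a convex set almost satisfies the variational inequality of the
  metric projection; unlike the projection itself it exists without closedness.\<close>

lemma almost_projection:
  assumes C: "C \<subseteq> H" "C \<noteq> {}"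
    and conv: "\<And>v w t. v \<in> C \<Longrightarrow> w \<in> C \<Longrightarrow> 0 \<le> t \<Longrightarrow> t \<le> 1 \<Longrightarrow> lincomb S (1 - t) v t w \<in> C"
    and f: "f \<in> H" and e: "e > 0"
  obtains v where "v \<in> C"
    "\<And>w t. w \<in> C \<Longrightarrow> 0 \<le> t \<Longrightarrow> t \<le> 1 \<Longrightarrow>
       2 * t * ip (lincomb S 1 f (-1) v) (lincomb S 1 w (-1) v)
         \<le> e + t\<^sup>2 * ip (lincomb S 1 w (-1) v) (lincomb S 1 w (-1) v)"
proof -
  define q where "q v = ip (lincomb S 1 f (-1) v) (lincomb S 1 f (-1) v)" for v
  have bdd: "bdd_below (q ` C)"
    using C f by (intro bdd_belowI[of _ 0]) (auto simp: q_def intro!: ip_nonneg)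
  obtain v where v: "v \<in> C" "q v < (INF v\<in>C. q v) + e"
    using cINF_less_iff[OF C(2) bdd, of "(INF v\<in>C. q v) + e"] e by auto
  have vH: "v \<in> H" using v C by auto
  show ?thesis
  proof
    fix w t assume w: "w \<in> C" and t: "0 \<le> t" "t \<le> (1::real)"
    have wH: "w \<in> H" using w C by auto
    \<comment> \<open>The point of the segment from \<open>v\<close> to \<open>w\<close> lies in
      \<open>C\<close> and cannot undercut the infimum, which \<open>q v\<close> exceeds by less
      than \<open>e\<close>; the rest expands the square.\<close>
    have "q v - e \<le> q (lincomb S (1 - t) v t w)"
      using v cINF_lower[OF bdd conv[OF v(1) w t]] by simp
    also have "\<dots> = q v - 2 * t * ip (lincomb S 1 f (-1) v) (lincomb S 1 w (-1) v)
       + t\<^sup>2 * ip (lincomb S 1 w (-1) v) (lincomb S 1 w (-1) v)"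
      using f vH wH
      by (simp add: q_def ip_lincomb ip_commute[of v f] ip_commute[of w f] ip_commute[of w v]
           algebra_simps power2_eq_square)
    finally show "2 * t * ip (lincomb S 1 f (-1) v) (lincomb S 1 w (-1) v)
         \<le> e + t\<^sup>2 * ip (lincomb S 1 w (-1) v) (lincomb S 1 w (-1) v)" by simp
  qed (use v in auto)
qed

end

context rkhs
begin

abbreviation ksec :: "'a \<Rightarrow> 'a \<Rightarrow> real" where
  "ksec x \<equiv> (\<lambda>x'\<in>S. k x' x)"

lemma ip_section_section: "x \<in> S \<Longrightarrow> y \<in> S \<Longrightarrow> ip (ksec x) (ksec y) = k y x"
  using reproducing[OF kernel_section, of x y] by simp

lemma kernel_diag_nonneg: "x \<in> S \<Longrightarrow> 0 \<le> k x x"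
  using ip_nonneg[OF kernel_section, of x] ip_section_section[of x x] by simp

text \<open>Cauchy-Schwarz against the section at \<open>x\<close>, whose norm is
  \<open>sqrt (k x x)\<close>. Through this bound norm estimates become uniform ones.\<close>

lemma eval_bound: "f \<in> H \<Longrightarrow> x \<in> S \<Longrightarrow> \<bar>f x\<bar> \<le> fs_norm ip f * sqrt (k x x)"
  using ip_le_fs_norm[of f "ksec x"] reproducing[of f x] kernel_section[of x]
  by (simp add: fs_norm_def ip_section_section)

lemma kernel_bound: "x \<in> S \<Longrightarrow> y \<in> S \<Longrightarrow> \<bar>k x y\<bar> \<le> sqrt (k x x) * sqrt (k y y)"
  using eval_bound[OF kernel_section, of y x] by (simp add: fs_norm_def ip_section_section mult.commute)

lemma ip_scaled_section:
  assumes "f \<in> H" "x \<in> S" shows "ip f (\<lambda>x'\<in>S. s * k x' x) = s * f x"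
proof -
  have "(\<lambda>x'\<in>S. s * k x' x) = lincomb S 0 f s (ksec x)"
    by (auto simp: lincomb_def restrict_def)
  then show ?thesis using assms kernel_section[OF assms(2)] reproducing[OF assms]
    by (simp add: ip_lincomb)
qed

text \<open>The measurable members form a subspace containing all sections. The residual of an
  almost projection onto it is nearly orthogonal to each section, that is, nearly zero at each
  point, so \<open>f\<close> is a pointwise limit of measurable functions. The risk integrals carry
  information only for measurable members.\<close>

lemma measurable_member:
  assumes M: "space M = S" and sec: "\<And>x. x \<in> S \<Longrightarrow> ksec x \<in> borel_measurable M"
    and f: "f \<in> H"
  shows "f \<in> borel_measurable M"
proof -
  define C where "C = {g \<in> H. g \<in> borel_measurable M}"
  have lc: "lincomb S a v b w \<in> C" if "v \<in> C" "w \<in> C" for a b v w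
  proof -
    have "(\<lambda>x. a * v x + b * w x) \<in> borel_measurable M" using that by (auto simp: C_def)
    then have "lincomb S a v b w \<in> borel_measurable M"
      using M by (subst measurable_cong[where g = "\<lambda>x. a * v x + b * w x"]) auto
    then show ?thesis using that by (auto simp: C_def)
  qed
  have "(\<lambda>x\<in>S. 0::real) \<in> borel_measurable M"
    using M by (subst measurable_cong[where g = "\<lambda>x. 0"]) auto
  then have ne: "C \<noteq> {}" using zero_closed by (auto simp: C_def)
  have CH: "C \<subseteq> H" by (auto simp: C_def)
  \<comment> \<open>The tolerance will be \<open>(t n)\<^sup>2\<close> and the step length
    \<open>t n\<close>, so that division by the step leaves an error of order
    \<open>t n\<close>.\<close>
  define t :: "nat \<Rightarrow> real" where "t n = 1 / (real n + 1)" for n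
  have t: "0 < t n" "t n \<le> 1" for n by (auto simp: t_def)
  have "\<exists>v\<in>C. \<forall>w\<in>C. 2 * t n * ip (lincomb S 1 f (-1) v) (lincomb S 1 w (-1) v)
       \<le> (t n)\<^sup>2 + (t n)\<^sup>2 * ip (lincomb S 1 w (-1) v) (lincomb S 1 w (-1) v)" for n
    using t[of n] by (rule_tac almost_projection[OF CH ne lc f, of "(t n)\<^sup>2"]) (auto intro!: bexI)
  then obtain v where v: "\<And>n. v n \<in> C" and
    p: "\<And>n w. w \<in> C \<Longrightarrow> 2 * t n * ip (lincomb S 1 f (-1) (v n)) (lincomb S 1 w (-1) (v n))
       \<le> (t n)\<^sup>2 + (t n)\<^sup>2 * ip (lincomb S 1 w (-1) (v n)) (lincomb S 1 w (-1) (v n))"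
    by metis
  have est: "\<bar>f x - v n x\<bar> \<le> t n * ((1 + k x x) / 2)" if x: "x \<in> S" for x n
  proof -
    have vH: "v n \<in> H" using v CH by auto
    have s: "ksec x \<in> C" using kernel_section sec x by (auto simp: C_def)
    have *: "2 * t n * (a * (f x - v n x)) \<le> (t n)\<^sup>2 + (t n)\<^sup>2 * (a\<^sup>2 * k x x)" for a
    proof -
      \<comment> \<open>Moving from \<open>v n\<close> along the section turns the inner product
        into the value of the residual at \<open>x\<close>; \<open>a = 1\<close> and
        \<open>a = -1\<close> together give the absolute value.\<close>
      let ?w = "lincomb S 1 (v n) a (ksec x)"
      have w: "?w \<in> C" using lc v s by auto
      have eq: "lincomb S 1 ?w (-1) (v n) = lincomb S 0 (v n) a (ksec x)"
        using vH s CH by (intro H_eqI) auto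
      show ?thesis using p[OF w, of n] vH s CH f x
        by (simp add: eq ip_lincomb reproducing[symmetric] kernel_section ip_section_section
             power2_eq_square mult.assoc right_diff_distrib)
    qed
    have "2 * t n * \<bar>f x - v n x\<bar> \<le> (t n)\<^sup>2 + (t n)\<^sup>2 * k x x"
      using *[of 1] *[of "-1"] by (simp add: abs_if)
    then have "t n * (2 * \<bar>f x - v n x\<bar>) \<le> t n * (t n * (1 + k x x))"
      by (simp add: algebra_simps power2_eq_square)
    then show ?thesis using t[of n] by simp
  qed
  have "t \<longlonglongrightarrow> 0" unfolding t_def by real_asymp
  then have lim: "(\<lambda>n. v n x) \<longlonglongrightarrow> f x" if "x \<in> S" for x
  proof -
    have "(\<lambda>n. t n * ((1 + k x x) / 2)) \<longlonglongrightarrow> 0"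
      using tendsto_mult_left_zero[OF \<open>t \<longlonglongrightarrow> 0\<close>] by simp
    then have "(\<lambda>n. f x - v n x) \<longlonglongrightarrow> 0"
      by (rule Lim_null_comparison[rotated]) (use est[OF that] in \<open>auto intro!: always_eventually\<close>)
    then show ?thesis
      using tendsto_diff[OF tendsto_const[of "f x"], of "\<lambda>n. f x - v n x" 0] by simp
  qed
  show ?thesis
    using v lim M by (intro borel_measurable_LIMSEQ_real[of M v f]) (auto simp: C_def)
qed

end

section \<open>Regularized risk minimization\<close>

definition reg_obj where
  "reg_obj ip R lam f = R f + (lam::real) * ip f f"

definition reg_min where
  "reg_min H ip R lam f \<longleftrightarrow> f \<in> H \<and> (\<forall>g\<in>H. reg_obj ip R lam f \<le> reg_obj ip R lam g)"

text \<open>The abstract \<open>R\<close> keeps the Hilbert space arguments free of measure theory.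
  Its Lipschitz condition refers to values on \<open>S\<close> and not to the norm of
  \<open>H\<close>, so the same \<open>R\<close> can be paired with another kernel;
  \<open>\<kappa>\<close> converts norms into uniform bounds.\<close>

locale regularized_risk = rkhs S k H ip
  for S :: "'a set" and k H ip +
  fixes R :: "('a \<Rightarrow> real) \<Rightarrow> real" and c lam \<kappa> :: real
  assumes lam_pos: "lam > 0" and c_nonneg: "0 \<le> c"
    and kappa: "0 \<le> \<kappa>" "\<And>x. x \<in> S \<Longrightarrow> sqrt (k x x) \<le> \<kappa>"
    and R_convex: "\<And>f g t. f \<in> H \<Longrightarrow> g \<in> H \<Longrightarrow> 0 \<le> t \<Longrightarrow> t \<le> 1 \<Longrightarrow>
      R (lincomb S (1 - t) f t g) \<le> (1 - t) * R f + t * R g"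
    and R_lipschitz: "\<And>f g e. f \<in> H \<Longrightarrow> g \<in> H \<Longrightarrow> (\<And>x. x \<in> S \<Longrightarrow> \<bar>f x - g x\<bar> \<le> e) \<Longrightarrow> 0 \<le> e \<Longrightarrow>
      \<bar>R f - R g\<bar> \<le> c * e"
begin

abbreviation obj :: "('a \<Rightarrow> real) \<Rightarrow> real" where
  "obj \<equiv> reg_obj ip R lam"

abbreviation is_min :: "('a \<Rightarrow> real) \<Rightarrow> bool" where
  "is_min \<equiv> reg_min H ip R lam"

lemma eval_le: "f \<in> H \<Longrightarrow> x \<in> S \<Longrightarrow> \<bar>f x\<bar> \<le> fs_norm ip f * \<kappa>"
  using eval_bound[of f x] mult_left_mono[OF kappa(2) fs_norm_nonneg, of x f] by linarith

lemma R_lipschitz_norm: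
  assumes "f \<in> H" "g \<in> H"
  shows "\<bar>R f - R g\<bar> \<le> c * (fs_norm ip (lincomb S 1 f (-1) g) * \<kappa>)"
proof (rule R_lipschitz[OF assms])
  show "\<bar>f x - g x\<bar> \<le> fs_norm ip (lincomb S 1 f (-1) g) * \<kappa>" if "x \<in> S" for x
    using eval_le[of "lincomb S 1 f (-1) g" x] assms that by auto
qed (use assms kappa fs_norm_nonneg in auto)

text \<open>For a squared Hilbert norm the convexity inequality has the exact defect
  \<open>t * (1 - t)\<close> times the squared distance. This defect is the only source of strong
  convexity, since \<open>R\<close> is merely convex.\<close>

lemma obj_convex:
  assumes "f \<in> H" "g \<in> H" "0 \<le> t" "t \<le> 1"
  shows "obj (lincomb S (1 - t) f t g) + lam * (t * (1 - t)) *
     ip (lincomb S 1 g (-1) f) (lincomb S 1 g (-1) f) \<le> (1 - t) * obj f + t * obj g"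
proof -
  have "lam * ip (lincomb S (1 - t) f t g) (lincomb S (1 - t) f t g) + lam * (t * (1 - t)) *
     ip (lincomb S 1 g (-1) f) (lincomb S 1 g (-1) f) = lam * ((1 - t) * ip f f + t * ip g g)"
    using assms by (simp add: ip_lincomb_self ip_commute[of g f] algebra_simps power2_eq_square)
  then show ?thesis using R_convex[OF assms]
    by (simp add: reg_obj_def algebra_simps)
qed

text \<open>Along the segment from \<open>f\<close> to \<open>g\<close>, minimality and
  \<open>obj_convex\<close> give the claim with an extra factor \<open>1 - t\<close> after division
  by \<open>t\<close>; letting \<open>t\<close> tend to 0 recovers the full constant
  \<open>lam\<close>.\<close>

lemma min_strong:
  assumes f: "is_min f" and g: "g \<in> H"
  shows "lam * ip (lincomb S 1 g (-1) f) (lincomb S 1 g (-1) f) \<le> obj g - obj f"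
proof -
  let ?d = "lam * ip (lincomb S 1 g (-1) f) (lincomb S 1 g (-1) f)"
  have fH: "f \<in> H" using f by (simp add: reg_min_def)
  have "(1 - t) * ?d \<le> obj g - obj f" if t: "0 < t" "t \<le> 1" for t
  proof -
    have "obj f \<le> obj (lincomb S (1 - t) f t g)" using f fH g by (simp add: reg_min_def)
    then have "t * ((1 - t) * ?d) \<le> t * (obj g - obj f)"
      using obj_convex[OF fH g, of t] t by (simp add: algebra_simps)
    then show ?thesis using t by simp
  qed
  then have "eventually (\<lambda>t. (1 - t) * ?d \<le> obj g - obj f) (at_right 0)"
    by (auto simp: eventually_at_right[of 0 1] intro!: exI[of _ 1])
  moreover have "((\<lambda>t. (1 - t) * ?d) \<longlongrightarrow> (1 - 0) * ?d) (at_right 0)"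
    by (intro tendsto_intros)
  ultimately show ?thesis
    using tendsto_upperbound[of "\<lambda>t. (1 - t) * ?d" "(1 - 0) * ?d" "at_right 0" "obj g - obj f"]
    by simp
qed

text \<open>One-sided differentiation along \<open>f - t u\<close> replaces a subgradient of the
  possibly nonsmooth \<open>R\<close>: the risk changes by at most \<open>c * (t * e)\<close>, the
  penalty to first order by \<open>2 * lam * t * ip f u\<close>. For varying \<open>u\<close> this
  bounds the functional \<open>ip f\<close> in the uniform norm.\<close>

lemma min_stationary:
  assumes f: "is_min f" and u: "u \<in> H" and e: "\<And>x. x \<in> S \<Longrightarrow> \<bar>u x\<bar> \<le> e" "0 \<le> e"
  shows "2 * lam * ip f u \<le> c * e"
proof -
  have fH: "f \<in> H" using f by (simp add: reg_min_def)
  have "2 * lam * ip f u - t * (lam * ip u u) \<le> c * e" if t: "0 < t" for t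
  proof -
    let ?g = "lincomb S 1 f (-t) u"
    have "\<bar>R ?g - R f\<bar> \<le> c * (t * e)"
      using fH u e t by (intro R_lipschitz) (auto simp: abs_mult intro!: mult_left_mono)
    moreover have "obj f \<le> obj ?g" using f fH u by (simp add: reg_min_def)
    moreover have "ip ?g ?g = ip f f - 2 * t * ip f u + t\<^sup>2 * ip u u"
      using fH u by (simp add: ip_lincomb_self)
    ultimately have "t * (2 * lam * ip f u - t * (lam * ip u u)) \<le> t * (c * e)"
      by (simp add: reg_obj_def algebra_simps power2_eq_square)
    then show ?thesis using t by simp
  qed
  then have "eventually (\<lambda>t. 2 * lam * ip f u - t * (lam * ip u u) \<le> c * e) (at_right 0)"
    by (auto simp: eventually_at_right[of 0 1] intro!: exI[of _ 1])
  moreover have "((\<lambda>t. 2 * lam * ip f u - t * (lam * ip u u)) \<longlongrightarrow> 2 * lam * ip f u - 0 * (lam * ip u u)) (at_right 0)"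
    by (intro tendsto_intros)
  ultimately show ?thesis
    using tendsto_upperbound[of "\<lambda>t. 2 * lam * ip f u - t * (lam * ip u u)"
        "2 * lam * ip f u - 0 * (lam * ip u u)" "at_right 0" "c * e"]
    by simp
qed

text \<open>Stationarity tested with \<open>u = f\<close> and
  \<open>e = fs_norm ip f * \<kappa>\<close>; one factor of the norm cancels.\<close>

lemma min_norm_le:
  assumes f: "is_min f"
  shows "fs_norm ip f \<le> c * \<kappa> / (2 * lam)"
proof (cases "fs_norm ip f = 0")
  case True
  then show ?thesis using c_nonneg kappa lam_pos by simp
next
  case False
  have fH: "f \<in> H" using f by (simp add: reg_min_def)
  then have pos: "fs_norm ip f > 0" using False fs_norm_nonneg[OF fH] by simp
  have "2 * lam * (fs_norm ip f)\<^sup>2 \<le> c * (fs_norm ip f * \<kappa>)"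
    using min_stationary[OF f fH eval_le[OF fH]] pos kappa fs_norm_sq[OF fH] by simp
  then have "fs_norm ip f * (2 * lam * fs_norm ip f) \<le> fs_norm ip f * (c * \<kappa>)"
    by (simp add: power2_eq_square algebra_simps)
  then show ?thesis using pos lam_pos by (simp add: field_simps)
qed

section \<open>Existence of minimizers by completeness\<close>

lemma obj_bdd_below: "bdd_below (obj ` H)"
proof (rule bdd_belowI2)
  fix f assume f: "f \<in> H"
  let ?z = "\<lambda>x\<in>S. 0::real" and ?n = "fs_norm ip f"
  have "lincomb S 1 f (-1) ?z = f" using f zero_closed by (intro H_eqI) auto
  then have "R ?z - c * (?n * \<kappa>) \<le> R f"
    using R_lipschitz_norm[OF f zero_closed] by simp
  moreover have "c * (?n * \<kappa>) \<le> lam * ?n\<^sup>2 + (c * \<kappa>)\<^sup>2 / (4 * lam)"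
  proof -
    \<comment> \<open>Completing the square lets the quadratic penalty absorb the linear growth of
      the risk, whence \<open>(c * \<kappa>)\<^sup>2 / (4 * lam)\<close>.\<close>
    have "0 \<le> (2 * lam * ?n - c * \<kappa>)\<^sup>2 / (4 * lam)" using lam_pos by simp
    also have "\<dots> = lam * ?n\<^sup>2 + (c * \<kappa>)\<^sup>2 / (4 * lam) - c * (?n * \<kappa>)"
      using lam_pos by (simp add: field_simps power2_eq_square)
    finally show ?thesis by simp
  qed
  ultimately show "R ?z - (c * \<kappa>)\<^sup>2 / (4 * lam) \<le> obj f"
    using fs_norm_sq[OF f] by (simp add: reg_obj_def)
qed

text \<open>A minimizing sequence is Cauchy by strong convexity at midpoints, so completeness
  supplies the limit. Existence provides the intermediate SVMs and makes the choice behind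
  \<open>svm\<close> meaningful.\<close>

lemma exists_min: "\<exists>f. is_min f"
proof -
  interpret MS: Metric_space H "fs_dist S H ip" by (rule Metric_space_fs_dist)
  define m where "m = (INF f\<in>H. obj f)"
  have m_le: "m \<le> obj f" if "f \<in> H" for f
    using cINF_lower[OF obj_bdd_below that] by (simp add: m_def)
  have "\<exists>f\<in>H. obj f < m + 1 / (real n + 1)" for n
    using cINF_less_iff[OF _ obj_bdd_below, of "m + 1 / (real n + 1)"] zero_closed
    by (auto simp: m_def)
  then obtain f where fH: "\<And>n. f n \<in> H" and f: "\<And>n. obj (f n) < m + 1 / (real n + 1)" by metis
  \<comment> \<open>The midpoint value is at least \<open>m\<close>, the average of the two values
    at most \<open>m + 1 / (real n + 1)\<close>; the defect at \<open>t = 1/2\<close> has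
    coefficient \<open>lam / 4\<close>, hence the factor \<open>4 / lam\<close>.\<close>
  have d2: "(fs_dist S H ip (f i) (f j))\<^sup>2 \<le> 4 / lam * (1 / (real n + 1))"
    if "n \<le> i" "n \<le> j" for i j n
  proof -
    let ?d = "lincomb S 1 (f j) (-1) (f i)"
    have "m + lam * (1/4) * ip ?d ?d \<le> (1/2) * obj (f i) + (1/2) * obj (f j)"
      using obj_convex[OF fH fH, of "1/2" i j] m_le[of "lincomb S (1/2) (f i) (1/2) (f j)"] fH
      by simp
    also have "\<dots> \<le> m + 1 / (real n + 1)"
    proof -
      have "1 / (real i + 1) \<le> 1 / (real n + 1)" "1 / (real j + 1) \<le> 1 / (real n + 1)"
        using that by (auto intro!: divide_left_mono)
      then show ?thesis using f[of i] f[of j] by argo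
    qed
    finally have "lam * ip ?d ?d \<le> 4 * (1 / (real n + 1))" by argo
    then have "ip ?d ?d \<le> 4 * (1 / (real n + 1)) / lam" using lam_pos
      by (simp only: pos_le_divide_eq mult.commute)
    then have "ip ?d ?d \<le> 4 / lam * (1 / (real n + 1))" by (simp add: mult.commute)
    moreover have "(fs_dist S H ip (f i) (f j))\<^sup>2 = ip ?d ?d"
      using fH by (simp add: MS.commute[of "f i"] fs_dist_eq fs_norm_sq)
    ultimately show ?thesis by simp
  qed
  have "MS.MCauchy f"
    unfolding MS.MCauchy_def
  proof (intro conjI allI impI)
    show "range f \<subseteq> H" using fH by auto
    fix e :: real assume e: "e > 0"
    have "(\<lambda>n. 4 / lam * (1 / (real n + 1))) \<longlonglongrightarrow> 0" by real_asymp
    then have "eventually (\<lambda>n. 4 / lam * (1 / (real n + 1)) < e\<^sup>2) sequentially"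
      using e by (intro order_tendstoD) auto
    then obtain N where N: "4 / lam * (1 / (real N + 1)) < e\<^sup>2"
      by (auto simp: eventually_sequentially)
    show "\<exists>N. \<forall>n n'. N \<le> n \<longrightarrow> N \<le> n' \<longrightarrow> fs_dist S H ip (f n) (f n') < e"
    proof (intro exI allI impI)
      fix n n' assume "N \<le> n" "N \<le> n'"
      from d2[OF this] N have "(fs_dist S H ip (f n) (f n'))\<^sup>2 < e\<^sup>2" by simp
      then show "fs_dist S H ip (f n) (f n') < e" using e by (simp add: power2_less_imp_less)
    qed
  qed
  then obtain g where "limitin MS.mtopology f g sequentially"
    using complete unfolding MS.mcomplete_def by blast
  then have g: "g \<in> H" and lim: "(\<lambda>n. fs_dist S H ip (f n) g) \<longlonglongrightarrow> 0"
    by (auto simp: MS.limitin_metric_dist_null)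
  have "obj g \<le> m"
  proof -
    define d where "d n = fs_norm ip (lincomb S 1 (f n) (-1) g)" for n
    have d0: "d \<longlonglongrightarrow> 0" using lim fH g unfolding d_def by (simp add: fs_dist_eq)
    \<comment> \<open>The risk is compared by its Lipschitz bound, the norm by expanding
      \<open>f n\<close> around \<open>g\<close> and dropping the nonnegative square of the
      difference. Both errors vanish with \<open>d n\<close>.\<close>
    have "obj g \<le> m + 1 / (real n + 1) + c * (d n * \<kappa>) + 2 * lam * (d n * fs_norm ip g)" for n
    proof -
      let ?d = "lincomb S 1 (f n) (-1) g"
      have "R g \<le> R (f n) + c * (d n * \<kappa>)"
        using R_lipschitz_norm[OF fH g, of n] by (simp add: d_def)
      moreover have "ip g g \<le> ip (f n) (f n) + 2 * (d n * fs_norm ip g)"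
      proof -
        have "ip (f n) (f n) = ip g g + 2 * ip ?d g + ip ?d ?d"
          using fH[of n] g by (simp add: ip_lincomb ip_commute[of g "f n"])
        moreover have "\<bar>ip ?d g\<bar> \<le> d n * fs_norm ip g"
          using ip_le_fs_norm[of ?d g] fH g by (simp add: d_def)
        moreover have "0 \<le> ip ?d ?d" using fH g by (intro ip_nonneg) auto
        ultimately show ?thesis by linarith
      qed
      then have "lam * ip g g \<le> lam * ip (f n) (f n) + 2 * lam * (d n * fs_norm ip g)"
        using mult_left_mono[of _ _ lam] lam_pos by (fastforce simp: algebra_simps)
      ultimately show ?thesis using f[of n] by (simp add: reg_obj_def)
    qed
    moreover have "(\<lambda>n. m + 1 / (real n + 1) + c * (d n * \<kappa>) + 2 * lam * (d n * fs_norm ip g))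
       \<longlonglongrightarrow> m + 0 + c * (0 * \<kappa>) + 2 * lam * (0 * fs_norm ip g)"
    proof (intro tendsto_intros d0)
      show "(\<lambda>n. 1 / (real n + 1)) \<longlonglongrightarrow> 0" by real_asymp
    qed
    ultimately show ?thesis
      by (intro LIMSEQ_le_const[where X = "\<lambda>n. m + 1 / (real n + 1) + c * (d n * \<kappa>) + 2 * lam * (d n * fs_norm ip g)"]) auto
  qed
  then have "is_min g" using g m_le by (force simp: reg_min_def)
  then show ?thesis by blast
qed

end

section \<open>Perturbing the parameter, the risk and the kernel\<close>

text \<open>Adding the two inequalities from \<open>min_strong\<close> cancels the risks and leaves
  \<open>(l2 - l1) * (ip f1 f1 - ip f2 f2)\<close> against a quadratic in the distance. The
  difference of squared norms is itself of first order in the distance, so one factor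
  cancels.\<close>

lemma svm_dist_regularization:
  assumes 1: "regularized_risk S k H ip R c l1 \<kappa>" and 2: "regularized_risk S k H ip R c l2 \<kappa>"
    and m1: "reg_min H ip R l1 f1" and m2: "reg_min H ip R l2 f2"
    and tau: "0 < \<tau>" "\<tau> \<le> l1" "\<tau> \<le> l2" and x: "x \<in> S"
  shows "\<bar>f1 x - f2 x\<bar> \<le> c * \<kappa>\<^sup>2 / \<tau>\<^sup>2 * \<bar>l1 - l2\<bar>"
proof -
  interpret A: regularized_risk S k H ip R c l1 \<kappa> by fact
  interpret B: regularized_risk S k H ip R c l2 \<kappa> by fact
  have H: "f1 \<in> H" "f2 \<in> H" using m1 m2 by (auto simp: reg_min_def)
  define d where "d = lincomb S 1 f1 (-1) f2"
  have dH: "d \<in> H" using H by (auto simp: d_def)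
  define n where "n = fs_norm ip d"
  have n0: "0 \<le> n" using dH by (simp add: n_def A.fs_norm_nonneg)
  have D: "ip d d = n\<^sup>2" using dH by (simp add: n_def A.fs_norm_sq)
  have eq: "ip (lincomb S 1 f2 (-1) f1) (lincomb S 1 f2 (-1) f1) = n\<^sup>2"
    unfolding D[symmetric] d_def using H by (simp add: A.ip_lincomb_self A.ip_commute[of f2 f1])
  have norm: "fs_norm ip f1 \<le> c * \<kappa> / (2 * \<tau>)" "fs_norm ip f2 \<le> c * \<kappa> / (2 * \<tau>)"
    using A.min_norm_le[OF m1] B.min_norm_le[OF m2] tau A.c_nonneg A.kappa(1)
      divide_left_mono[of "2 * \<tau>" "2 * l1" "c * \<kappa>"] divide_left_mono[of "2 * \<tau>" "2 * l2" "c * \<kappa>"]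
    by auto
  have "ip f1 f1 - ip f2 f2 = ip d f1 + ip d f2"
    using H by (simp add: d_def A.ip_lincomb A.ip_commute[of f2 f1])
  also have "\<bar>\<dots>\<bar> \<le> n * fs_norm ip f1 + n * fs_norm ip f2"
    using A.ip_le_fs_norm[OF dH H(1)] A.ip_le_fs_norm[OF dH H(2)] by (simp add: n_def)
  also have "\<dots> \<le> n * (c * \<kappa> / (2 * \<tau>)) + n * (c * \<kappa> / (2 * \<tau>))"
    using norm n0 by (intro add_mono mult_left_mono) auto
  finally have q: "\<bar>ip f1 f1 - ip f2 f2\<bar> \<le> n * (c * \<kappa> / \<tau>)" by (simp add: mult_ac)
  have "2 * \<tau> * n\<^sup>2 \<le> (l1 + l2) * n\<^sup>2"
    using tau by (intro mult_right_mono) auto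
  also have "\<dots> \<le> (l2 - l1) * (ip f1 f1 - ip f2 f2)"
    using A.min_strong[OF m1 H(2)] B.min_strong[OF m2 H(1)] D eq
    by (simp add: reg_obj_def d_def algebra_simps)
  also have "\<dots> \<le> \<bar>l1 - l2\<bar> * \<bar>ip f1 f1 - ip f2 f2\<bar>"
    by (simp add: abs_mult[symmetric] abs_minus_commute[of l1 l2])
  also have "\<dots> \<le> \<bar>l1 - l2\<bar> * (n * (c * \<kappa> / \<tau>))"
    by (intro mult_left_mono q) auto
  finally have le: "n * (2 * \<tau> * n) \<le> n * (\<bar>l1 - l2\<bar> * (c * \<kappa> / \<tau>))"
    by (simp add: power2_eq_square algebra_simps)
  have "n \<le> \<bar>l1 - l2\<bar> * (c * \<kappa> / \<tau>) / \<tau>"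
  proof (cases "n = 0")
    case True
    then show ?thesis using tau A.c_nonneg A.kappa(1) by simp
  next
    case False
    then have "2 * \<tau> * n \<le> \<bar>l1 - l2\<bar> * (c * \<kappa> / \<tau>)" using le n0
      by (simp only: mult_le_cancel_left)
    \<comment> \<open>A factor 2 is given away here to meet the stated constant.\<close>
    moreover have "n * \<tau> \<le> 2 * \<tau> * n" using tau n0 by simp
    ultimately have "n * \<tau> \<le> \<bar>l1 - l2\<bar> * (c * \<kappa> / \<tau>)" by linarith
    then show ?thesis using tau by (simp only: pos_le_divide_eq)
  qed
  then have "n * \<kappa> \<le> \<bar>l1 - l2\<bar> * (c * \<kappa> / \<tau>) / \<tau> * \<kappa>"
    using A.kappa(1) by (intro mult_right_mono)
  moreover have "\<bar>f1 x - f2 x\<bar> \<le> n * \<kappa>"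
    using A.eval_le[OF dH x] x by (simp add: n_def d_def)
  ultimately show ?thesis by (simp add: power2_eq_square mult_ac)
qed

text \<open>Here adding the two inequalities from \<open>min_strong\<close> cancels the norms.
  Assumption \<open>T\<close> is phrased for increments of the risks because these scale with the
  distance of the two functions, so again one factor of the distance cancels.\<close>

lemma svm_dist_risk:
  assumes 1: "regularized_risk S k H ip R1 c lam \<kappa>" and 2: "regularized_risk S k H ip R2 c lam \<kappa>"
    and m1: "reg_min H ip R1 lam f1" and m2: "reg_min H ip R2 lam f2"
    and T: "0 \<le> T" "\<And>f g e. f \<in> H \<Longrightarrow> g \<in> H \<Longrightarrow> (\<And>x. x \<in> S \<Longrightarrow> \<bar>f x - g x\<bar> \<le> e) \<Longrightarrow> 0 \<le> e \<Longrightarrow>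
      \<bar>(R1 f - R1 g) - (R2 f - R2 g)\<bar> \<le> c * e * T"
    and x: "x \<in> S"
  shows "\<bar>f1 x - f2 x\<bar> \<le> c * \<kappa>\<^sup>2 / lam * T"
proof -
  interpret A: regularized_risk S k H ip R1 c lam \<kappa> by fact
  interpret B: regularized_risk S k H ip R2 c lam \<kappa> by fact
  have H: "f1 \<in> H" "f2 \<in> H" using m1 m2 by (auto simp: reg_min_def)
  define d where "d = lincomb S 1 f1 (-1) f2"
  have dH: "d \<in> H" using H by (auto simp: d_def)
  define n where "n = fs_norm ip d"
  have n0: "0 \<le> n" using dH by (simp add: n_def A.fs_norm_nonneg)
  have D: "ip d d = n\<^sup>2" using dH by (simp add: n_def A.fs_norm_sq)
  have eq: "ip (lincomb S 1 f2 (-1) f1) (lincomb S 1 f2 (-1) f1) = n\<^sup>2"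
    unfolding D[symmetric] d_def using H by (simp add: A.ip_lincomb_self A.ip_commute[of f2 f1])
  have ev: "\<bar>f1 y - f2 y\<bar> \<le> n * \<kappa>" if "y \<in> S" for y
    using A.eval_le[OF dH that] that by (simp add: n_def d_def)
  have "2 * lam * n\<^sup>2 \<le> - ((R1 f1 - R1 f2) - (R2 f1 - R2 f2))"
    using A.min_strong[OF m1 H(2)] B.min_strong[OF m2 H(1)] D eq
    by (simp add: reg_obj_def d_def algebra_simps)
  also have "\<dots> \<le> c * (n * \<kappa>) * T"
    using T(2)[OF H ev] n0 A.kappa(1) by simp
  finally have le: "n * (2 * lam * n) \<le> n * (c * \<kappa> * T)"
    by (simp add: power2_eq_square algebra_simps)
  have "n \<le> c * \<kappa> * T / lam"
  proof (cases "n = 0")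
    case True
    then show ?thesis using T(1) A.lam_pos A.c_nonneg A.kappa(1) by simp
  next
    case False
    then have "2 * lam * n \<le> c * \<kappa> * T" using le n0 by simp
    moreover have "n * lam \<le> 2 * lam * n" using A.lam_pos n0 by simp
    ultimately have "n * lam \<le> c * \<kappa> * T" by linarith
    then show ?thesis using A.lam_pos by (simp only: pos_le_divide_eq)
  qed
  then have "n * \<kappa> \<le> c * \<kappa> * T / lam * \<kappa>"
    using A.kappa(1) by (intro mult_right_mono)
  then show ?thesis using ev[OF x] by (simp add: power2_eq_square mult_ac)
qed

text \<open>Pairs with equal coefficients: \<open>v1\<close> and \<open>v2\<close> are the same combination, of total coefficient
  mass at most \<open>A\<close>, of sections of \<open>k1\<close> and of \<open>k2\<close>. The inductive form avoids finite sums.\<close>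

inductive kernel_hull :: "'a set \<Rightarrow> ('a \<Rightarrow> 'a \<Rightarrow> real) \<Rightarrow> ('a \<Rightarrow> 'a \<Rightarrow> real) \<Rightarrow> real
    \<Rightarrow> ('a \<Rightarrow> real) \<Rightarrow> ('a \<Rightarrow> real) \<Rightarrow> bool" for S k1 k2 A where
  base: "x \<in> S \<Longrightarrow> \<bar>s\<bar> \<le> A \<Longrightarrow>
    kernel_hull S k1 k2 A (\<lambda>x'\<in>S. s * k1 x' x) (\<lambda>x'\<in>S. s * k2 x' x)"
| comb: "kernel_hull S k1 k2 A v1 v2 \<Longrightarrow> kernel_hull S k1 k2 A w1 w2 \<Longrightarrow> 0 \<le> t \<Longrightarrow> t \<le> 1 \<Longrightarrow>
    kernel_hull S k1 k2 A (lincomb S (1 - t) v1 t w1) (lincomb S (1 - t) v2 t w2)"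

section \<open>Uniform estimates for paired combinations of kernel sections\<close>

lemma abs_convex_comb_le:
  fixes t :: real
  assumes "0 \<le> t" "t \<le> 1" "\<bar>a\<bar> \<le> m" "\<bar>b\<bar> \<le> m"
  shows "\<bar>(1 - t) * a + t * b\<bar> \<le> m"
proof -
  have "\<bar>(1 - t) * a + t * b\<bar> \<le> (1 - t) * \<bar>a\<bar> + t * \<bar>b\<bar>"
    using assms(1,2) abs_triangle_ineq[of "(1 - t) * a" "t * b"] by (simp add: abs_mult)
  also have "\<dots> \<le> (1 - t) * m + t * m"
    using assms by (intro add_mono mult_left_mono) auto
  finally show ?thesis by (simp add: algebra_simps)
qed

lemma kernel_hull_diff:
  assumes d: "\<And>x y. x \<in> S \<Longrightarrow> y \<in> S \<Longrightarrow> \<bar>k1 x y - k2 x y\<bar> \<le> \<delta>"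
    and h: "kernel_hull S k1 k2 A v1 v2" and x: "x \<in> S"
  shows "\<bar>v1 x - v2 x\<bar> \<le> A * \<delta>"
  using h
proof induction
  case (base y s)
  have "\<bar>s\<bar> * \<bar>k1 x y - k2 x y\<bar> \<le> A * \<delta>"
    using base d[OF x base(1)] by (intro mult_mono) auto
  then show ?case using x by (simp add: abs_mult[symmetric] right_diff_distrib)
next
  case (comb v1 v2 w1 w2 t)
  have "\<bar>(1 - t) * (v1 x - v2 x) + t * (w1 x - w2 x)\<bar> \<le> A * \<delta>"
    using comb by (intro abs_convex_comb_le)
  then show ?case using x by (simp add: algebra_simps)
qed

lemma kernel_hull_closed:
  assumes "rkhs S k1 H1 ip1" "rkhs S k2 H2 ip2"
    and h: "kernel_hull S k1 k2 A v1 v2"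
  shows "v1 \<in> H1" "v2 \<in> H2"
proof -
  interpret A: rkhs S k1 H1 ip1 by fact
  interpret B: rkhs S k2 H2 ip2 by fact
  have "v1 \<in> H1 \<and> v2 \<in> H2"
    using h
  proof induction
    case (base x s)
    have "(\<lambda>x'\<in>S. s * k1 x' x) = (\<lambda>x'\<in>S. s * A.ksec x x')" "(\<lambda>x'\<in>S. s * k2 x' x) = (\<lambda>x'\<in>S. s * B.ksec x x')"
      by (auto simp: restrict_def)
    then show ?case
      using A.scale_closed[OF A.kernel_section[OF base(1)], of s]
        B.scale_closed[OF B.kernel_section[OF base(1)], of s] by (simp only: simp_thms)
  qed auto
  then show "v1 \<in> H1" "v2 \<in> H2" by auto
qed

text \<open>Induction on the second pair alone suffices: against a scaled section the reproducing
  property turns both inner products into values of \<open>v1\<close> and \<open>v2\<close>, where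
  \<open>kernel_hull_diff\<close> applies, and the bound survives convex combinations.\<close>

lemma kernel_hull_ip:
  assumes 1: "rkhs S k1 H1 ip1" and 2: "rkhs S k2 H2 ip2" and A: "0 \<le> A"
    and d: "\<And>x y. x \<in> S \<Longrightarrow> y \<in> S \<Longrightarrow> \<bar>k1 x y - k2 x y\<bar> \<le> \<delta>"
    and v: "kernel_hull S k1 k2 A v1 v2" and w: "kernel_hull S k1 k2 A w1 w2"
  shows "\<bar>ip1 v1 w1 - ip2 v2 w2\<bar> \<le> A\<^sup>2 * \<delta>"
proof -
  interpret A: rkhs S k1 H1 ip1 by fact
  interpret B: rkhs S k2 H2 ip2 by fact
  note cl = kernel_hull_closed[OF 1 2]
  show ?thesis using w
  proof induction
    case (base x s)
    have "\<bar>s\<bar> * \<bar>v1 x - v2 x\<bar> \<le> A * (A * \<delta>)"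
      using A base kernel_hull_diff[OF d v base(1)] by (intro mult_mono) auto
    then show ?case
      unfolding A.ip_scaled_section[OF cl(1)[OF v] base(1)] B.ip_scaled_section[OF cl(2)[OF v] base(1)]
      by (simp add: abs_mult[symmetric] right_diff_distrib power2_eq_square mult.assoc)
  next
    case (comb v1' v2' w1 w2 t)
    have "\<bar>(1 - t) * (ip1 v1 v1' - ip2 v2 v2') + t * (ip1 v1 w1 - ip2 v2 w2)\<bar> \<le> A\<^sup>2 * \<delta>"
      using comb by (intro abs_convex_comb_le)
    then show ?case using cl[OF v] cl[OF comb(1)] cl[OF comb(2)]
      by (simp add: A.ip_lincomb B.ip_lincomb algebra_simps)
  qed
qed

text \<open>The same induction, run first for values and then for inner products. The bound is
  uniform over the hull, so a step length can be fixed before the almost projection is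
  chosen.\<close>

lemma kernel_hull_ip_bound:
  assumes 1: "rkhs S k1 H1 ip1" and 2: "rkhs S k2 H2 ip2" and A: "0 \<le> A"
    and d: "\<And>x y. x \<in> S \<Longrightarrow> y \<in> S \<Longrightarrow> \<bar>k1 x y\<bar> \<le> K"
    and v: "kernel_hull S k1 k2 A v1 v2" and w: "kernel_hull S k1 k2 A w1 w2"
  shows "\<bar>ip1 v1 w1\<bar> \<le> A\<^sup>2 * K"
proof -
  interpret A: rkhs S k1 H1 ip1 by fact
  note cl = kernel_hull_closed[OF 1 2]
  have ev: "\<bar>v1 x\<bar> \<le> A * K" if x: "x \<in> S" for x
    using v
  proof induction
    case (base y s)
    then show ?case using x d[OF x base(1)] by (auto simp: abs_mult intro!: mult_mono)
  next
    case (comb v1 v2 w1 w2 t)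
    then show ?case using x by (auto intro!: abs_convex_comb_le)
  qed
  show ?thesis using w
  proof induction
    case (base x s)
    have "\<bar>s\<bar> * \<bar>v1 x\<bar> \<le> A * (A * K)"
      using A base(2) by (intro mult_mono ev[OF base(1)]) auto
    then show ?case
      unfolding A.ip_scaled_section[OF cl(1)[OF v] base(1)]
      by (simp add: abs_mult power2_eq_square mult.assoc)
  next
    case (comb v1' v2' w1 w2 t)
    then show ?case using cl[OF v] cl[OF comb(1)] cl[OF comb(2)]
      by (auto simp: A.ip_lincomb intro!: abs_convex_comb_le)
  qed
qed

text \<open>A substitute for the representer theorem: an almost projection onto the hull, tested against
  the scaled sections, contradicts first-order optimality unless it is close to \<open>f\<close>.\<close>

lemma min_in_kernel_hull:
  assumes 1: "regularized_risk S k1 H1 ip1 R c lam \<kappa>" and 2: "rkhs S k2 H2 ip2"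
    and ne: "S \<noteq> {}" and m: "reg_min H1 ip1 R lam f" and e: "0 < e"
  obtains v1 v2 where "kernel_hull S k1 k2 (c / (2 * lam)) v1 v2"
    "ip1 (lincomb S 1 f (-1) v1) (lincomb S 1 f (-1) v1) \<le> e"
proof -
  interpret A: regularized_risk S k1 H1 ip1 R c lam \<kappa> by fact
  note A1 = A.rkhs_axioms
  note cl = kernel_hull_closed[OF A1 2]
  define A where "A = c / (2 * lam)"
  have A0: "0 \<le> A" using A.lam_pos A.c_nonneg by (simp add: A_def)
  have cA: "c = 2 * lam * A" using A.lam_pos by (simp add: A_def)
  have fH: "f \<in> H1" using m by (simp add: reg_min_def)
  define C where "C = {v. \<exists>v2. kernel_hull S k1 k2 A v v2}"
  have CH: "C \<subseteq> H1" using cl by (auto simp: C_def)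
  obtain x0 where x0: "x0 \<in> S" using ne by auto
  have baseC: "(\<lambda>x'\<in>S. s * k1 x' x) \<in> C" if "x \<in> S" "\<bar>s\<bar> \<le> A" for x s
    using kernel_hull.base[OF that] by (auto simp: C_def)
  have Cne: "C \<noteq> {}" using baseC[OF x0, of 0] A0 by auto
  define K where "K = A\<^sup>2 * \<kappa>\<^sup>2"
  have K0: "0 \<le> K" by (simp add: K_def)
  have k1: "\<bar>k1 x y\<bar> \<le> \<kappa>\<^sup>2" if "x \<in> S" "y \<in> S" for x y
  proof -
    have "\<bar>k1 x y\<bar> \<le> sqrt (k1 x x) * sqrt (k1 y y)" by (rule A.kernel_bound[OF that])
    also have "\<dots> \<le> \<kappa> * \<kappa>" using that A.kappa A.kernel_diag_nonneg by (intro mult_mono) auto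
    finally show ?thesis by (simp add: power2_eq_square)
  qed
  have ipC: "\<bar>ip1 v w\<bar> \<le> K" if "v \<in> C" "w \<in> C" for v w
    using that kernel_hull_ip_bound[OF A1 2 A0 k1] by (auto simp: C_def K_def)
  \<comment> \<open>With tolerance \<open>t\<^sup>2\<close> and squared diameter at most
    \<open>4 * K\<close>, division by \<open>t\<close> leaves the error
    \<open>t * (1 + 4 * K)\<close>, which this choice keeps at most \<open>e\<close>.\<close>
  define t where "t = min 1 (e / (1 + 4 * K))"
  have t: "0 < t" "t \<le> 1" using e K0 by (auto simp: t_def)
  have "t * (1 + 4 * K) \<le> e / (1 + 4 * K) * (1 + 4 * K)"
    using K0 by (intro mult_right_mono) (auto simp: t_def)
  then have te: "t * (1 + 4 * K) \<le> e" using K0 by simp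
  obtain v where vC: "v \<in> C" and v: "\<And>w. w \<in> C \<Longrightarrow>
       2 * t * ip1 (lincomb S 1 f (-1) v) (lincomb S 1 w (-1) v)
         \<le> t\<^sup>2 + t\<^sup>2 * ip1 (lincomb S 1 w (-1) v) (lincomb S 1 w (-1) v)"
  proof (rule A.almost_projection[OF CH Cne _ fH, of "t\<^sup>2"])
    show "lincomb S (1 - t) v t w \<in> C" if "v \<in> C" "w \<in> C" "0 \<le> t" "t \<le> 1" for v w t
      using that kernel_hull.comb by (fastforce simp: C_def)
    fix v assume "v \<in> C" and *: "\<And>w s. w \<in> C \<Longrightarrow> 0 \<le> s \<Longrightarrow> s \<le> 1 \<Longrightarrow>
       2 * s * ip1 (lincomb S 1 f (-1) v) (lincomb S 1 w (-1) v)
         \<le> t\<^sup>2 + s\<^sup>2 * ip1 (lincomb S 1 w (-1) v) (lincomb S 1 w (-1) v)"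
    then show thesis using that[of v] t by simp
  qed (use t in auto)
  define u where "u = lincomb S 1 f (-1) v"
  have vH: "v \<in> H1" using vC CH by auto
  have uH: "u \<in> H1" using vH fH by (auto simp: u_def)
  have uw: "ip1 u w \<le> ip1 u v + e" if w: "w \<in> C" for w
  proof -
    have wH: "w \<in> H1" using w CH by auto
    have "ip1 (lincomb S 1 w (-1) v) (lincomb S 1 w (-1) v) = ip1 w w - 2 * ip1 w v + ip1 v v"
      using wH vH by (simp add: A.ip_lincomb_self)
    also have "\<dots> \<le> 4 * K" using ipC[OF w w] ipC[OF w vC] ipC[OF vC vC] by linarith
    finally have q: "t\<^sup>2 * ip1 (lincomb S 1 w (-1) v) (lincomb S 1 w (-1) v) \<le> t\<^sup>2 * (4 * K)"
      by (intro mult_left_mono) auto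
    have "2 * t * ip1 u (lincomb S 1 w (-1) v) \<le> t\<^sup>2 + t\<^sup>2 * (4 * K)"
      using v[OF w] q unfolding u_def by linarith
    then have "t * (2 * (ip1 u w - ip1 u v)) \<le> t * (t * (1 + 4 * K))"
      using uH wH vH by (simp add: A.ip_lincomb algebra_simps power2_eq_square)
    then have "2 * (ip1 u w - ip1 u v) \<le> e" using t te by simp
    then show ?thesis using e by argo
  qed
  \<comment> \<open>The hull contains the section at \<open>x\<close> scaled by both signs of
    \<open>A\<close>, whence the absolute value.\<close>
  have ux: "A * \<bar>u x\<bar> \<le> ip1 u v + e" if "x \<in> S" for x
  proof -
    have "s * u x \<le> ip1 u v + e" if "\<bar>s\<bar> \<le> A" for s
      using uw[OF baseC[OF \<open>x \<in> S\<close> that]] A.ip_scaled_section[OF uH \<open>x \<in> S\<close>, of s] by linarith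
    from this[of A] this[of "-A"] show ?thesis using A0 by (simp add: abs_if)
  qed
  have "ip1 f u \<le> ip1 u v + e"
  \<comment> \<open>If \<open>A = 0\<close> then \<open>c = 0\<close>, and stationarity forces
    \<open>ip1 f u \<le> 0\<close>. Otherwise \<open>(ip1 u v + e) / A\<close> is a uniform bound
    for \<open>u\<close>, and \<open>c = 2 * lam * A\<close> cancels.\<close>
  proof (cases "A = 0")
    case True
    have "2 * lam * ip1 f u \<le> c * (fs_norm ip1 u * \<kappa>)"
      using A.eval_le[OF uH] A.fs_norm_nonneg[OF uH] A.kappa(1)
      by (intro A.min_stationary[OF m uH]) auto
    then have "ip1 f u \<le> 0" using True cA A.lam_pos by (simp add: mult_le_0_iff)
    then show ?thesis using ux[OF x0] True by simp
  next
    case False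
    then have Apos: "A > 0" using A0 by simp
    have nn: "0 \<le> ip1 u v + e" using ux[OF x0] A0 by (meson abs_ge_zero mult_nonneg_nonneg order_trans)
    have "2 * lam * ip1 f u \<le> c * ((ip1 u v + e) / A)"
      using ux Apos nn by (intro A.min_stationary[OF m uH]) (auto simp: pos_le_divide_eq mult.commute)
    then show ?thesis using Apos A.lam_pos by (simp add: cA)
  qed
  \<comment> \<open>Since \<open>u\<close> is \<open>f - v\<close>, subtracting
    \<open>ip1 u v\<close> from \<open>ip1 f u\<close> leaves \<open>ip1 u u\<close>.\<close>
  then have "ip1 u u \<le> e"
    using A.ip_lincomb_right[OF fH vH uH, of 1 "-1"] A.ip_commute[OF fH uH] by (simp add: u_def)
  then show ?thesis using that vC by (auto simp: C_def u_def A_def)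
qed

lemma svm_dist_kernel_asym:
  assumes 1: "regularized_risk S k1 H1 ip1 R c lam \<kappa>" and 2: "regularized_risk S k2 H2 ip2 R c lam \<kappa>"
    and ne: "S \<noteq> {}"
    and m1: "reg_min H1 ip1 R lam f1" and m2: "reg_min H2 ip2 R lam f2"
    and lip: "\<And>f g e. f \<in> H1 \<Longrightarrow> g \<in> H2 \<Longrightarrow> (\<And>x. x \<in> S \<Longrightarrow> \<bar>f x - g x\<bar> \<le> e) \<Longrightarrow> 0 \<le> e \<Longrightarrow>
      \<bar>R f - R g\<bar> \<le> c * e"
    and d: "\<And>x y. x \<in> S \<Longrightarrow> y \<in> S \<Longrightarrow> \<bar>k1 x y - k2 x y\<bar> \<le> \<delta>"
    and le: "reg_obj ip1 R lam f1 \<le> reg_obj ip2 R lam f2"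
    and x: "x \<in> S"
  shows "\<bar>f1 x - f2 x\<bar> \<le> c / lam * (1 / 2 * \<delta> + \<kappa> * sqrt \<delta>)"
proof -
  interpret A: regularized_risk S k1 H1 ip1 R c lam \<kappa> by fact
  interpret B: regularized_risk S k2 H2 ip2 R c lam \<kappa> by fact
  have H: "f1 \<in> H1" "f2 \<in> H2" using m1 m2 by (auto simp: reg_min_def)
  define A where "A = c / (2 * lam)"
  have A0: "0 \<le> A" using A.lam_pos A.c_nonneg by (simp add: A_def)
  have d0: "0 \<le> \<delta>" using d[OF x x] by linarith
  \<comment> \<open>The price in objective value of replacing \<open>f1\<close> by \<open>g\<close>:
    a risk part from the uniform distance, and a norm part from the change of kernel and from the
    accuracy \<open>r\<close> of the hull approximation.\<close>
  define \<rho> where "\<rho> r = c * (\<kappa> * r + A * \<delta>) + lam * (A\<^sup>2 * \<delta> + 2 * fs_norm ip1 f1 * r + r\<^sup>2)" for r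
  have main: "\<bar>f1 x - f2 x\<bar> \<le> \<kappa> * r + A * \<delta> + sqrt (\<rho> r / lam) * \<kappa>" if r: "0 < r" for r
  proof -
    obtain v g where h: "kernel_hull S k1 k2 A v g"
      and u2: "ip1 (lincomb S 1 f1 (-1) v) (lincomb S 1 f1 (-1) v) \<le> r\<^sup>2"
      using min_in_kernel_hull[OF 1 B.rkhs_axioms ne m1, of "r\<^sup>2"] r unfolding A_def by auto
    define u where "u = lincomb S 1 f1 (-1) v"
    have vH: "v \<in> H1" and gH: "g \<in> H2"
      using kernel_hull_closed[OF A.rkhs_axioms B.rkhs_axioms h] by auto
    have uH: "u \<in> H1" using vH H by (auto simp: u_def)
    have nu: "fs_norm ip1 u \<le> r"
      using u2 r unfolding fs_norm_def u_def by (simp add: real_le_lsqrt)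
    have fg: "\<bar>f1 y - g y\<bar> \<le> \<kappa> * r + A * \<delta>" if y: "y \<in> S" for y
    proof -
      have "\<bar>f1 y - v y\<bar> \<le> fs_norm ip1 u * \<kappa>" using A.eval_le[OF uH y] y by (simp add: u_def)
      also have "\<dots> \<le> r * \<kappa>" using nu A.kappa(1) by (intro mult_right_mono)
      finally show ?thesis using kernel_hull_diff[OF d h y] by (simp add: mult.commute)
    qed
    have "R g \<le> R f1 + c * (\<kappa> * r + A * \<delta>)"
      using lip[OF H(1) gH fg] A0 d0 r A.kappa(1) by simp
    moreover have "ip2 g g \<le> ip1 f1 f1 + (A\<^sup>2 * \<delta> + 2 * fs_norm ip1 f1 * r + r\<^sup>2)"
    proof -
      have "v = lincomb S 1 f1 (-1) u" using vH H by (intro A.H_eqI) (auto simp: u_def)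
      then have "ip1 v v = ip1 f1 f1 - 2 * ip1 f1 u + ip1 u u"
        using A.ip_lincomb_self[OF H(1) uH, of 1 "-1"] by simp
      moreover have "\<bar>ip1 f1 u\<bar> \<le> fs_norm ip1 f1 * fs_norm ip1 u" by (rule A.ip_le_fs_norm[OF H(1) uH])
      moreover have "fs_norm ip1 f1 * fs_norm ip1 u \<le> fs_norm ip1 f1 * r"
        using nu A.fs_norm_nonneg[OF H(1)] by (intro mult_left_mono)
      moreover have "\<bar>ip1 v v - ip2 g g\<bar> \<le> A\<^sup>2 * \<delta>"
        by (rule kernel_hull_ip[OF A.rkhs_axioms B.rkhs_axioms A0 d h h])
      ultimately show ?thesis using u2 unfolding u_def[symmetric] by linarith
    qed
    then have "lam * ip2 g g \<le> lam * (ip1 f1 f1 + (A\<^sup>2 * \<delta> + 2 * fs_norm ip1 f1 * r + r\<^sup>2))"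
      using A.lam_pos by (intro mult_left_mono) auto
    ultimately have "reg_obj ip2 R lam g \<le> reg_obj ip1 R lam f1 + \<rho> r"
      by (simp add: reg_obj_def \<rho>_def distrib_left)
    \<comment> \<open>By \<open>le\<close> the value of \<open>f1\<close> is at most the optimum of
      the second problem, so \<open>g\<close> is nearly optimal there.\<close>
    then have "lam * ip2 (lincomb S 1 g (-1) f2) (lincomb S 1 g (-1) f2) \<le> \<rho> r"
      using B.min_strong[OF m2 gH] le by linarith
    then have "fs_norm ip2 (lincomb S 1 g (-1) f2) \<le> sqrt (\<rho> r / lam)"
      using A.lam_pos by (simp add: fs_norm_def pos_le_divide_eq mult.commute)
    then have "fs_norm ip2 (lincomb S 1 g (-1) f2) * \<kappa> \<le> sqrt (\<rho> r / lam) * \<kappa>"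
      using A.kappa(1) by (intro mult_right_mono)
    moreover have "\<bar>g x - f2 x\<bar> \<le> fs_norm ip2 (lincomb S 1 g (-1) f2) * \<kappa>"
      using B.eval_le[of "lincomb S 1 g (-1) f2" x] gH H x by simp
    ultimately show ?thesis using fg[OF x] by linarith
  qed
  \<comment> \<open>\<open>v\<close> and \<open>g\<close> vary with \<open>r\<close>, but the
    estimate no longer mentions them, so the limit is taken in the bound alone.\<close>
  have "((\<lambda>r. \<kappa> * r + A * \<delta> + sqrt (\<rho> r / lam) * \<kappa>) \<longlongrightarrow> \<kappa> * 0 + A * \<delta> + sqrt (\<rho> 0 / lam) * \<kappa>) (at_right 0)"
    unfolding \<rho>_def using A.lam_pos by (intro tendsto_intros) auto
  moreover have "eventually (\<lambda>r. \<bar>f1 x - f2 x\<bar> \<le> \<kappa> * r + A * \<delta> + sqrt (\<rho> r / lam) * \<kappa>) (at_right 0)"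
    using main by (auto simp: eventually_at_right[of 0 1] intro!: exI[of _ 1])
  ultimately have "\<bar>f1 x - f2 x\<bar> \<le> \<kappa> * 0 + A * \<delta> + sqrt (\<rho> 0 / lam) * \<kappa>"
    by (intro tendsto_lowerbound) auto
  moreover have "sqrt (\<rho> 0 / lam) \<le> c / lam * sqrt \<delta>"
  proof -
    \<comment> \<open>Of the factor 3/4, the risk part \<open>c * (A * \<delta>)\<close> contributes
      1/2 and the norm part \<open>lam * (A\<^sup>2 * \<delta>)\<close> contributes 1/4; it is then
      rounded up to 1.\<close>
    have "\<rho> 0 / lam = 3 / 4 * ((c / lam)\<^sup>2 * \<delta>)"
      using A.lam_pos by (simp add: \<rho>_def A_def field_simps power2_eq_square)
    also have "\<dots> \<le> (c / lam)\<^sup>2 * \<delta>" using d0 by simp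
    finally have "sqrt (\<rho> 0 / lam) \<le> sqrt ((c / lam)\<^sup>2 * \<delta>)" by (rule real_sqrt_le_mono)
    then show ?thesis using A.lam_pos A.c_nonneg by (simp add: real_sqrt_mult)
  qed
  then have "sqrt (\<rho> 0 / lam) * \<kappa> \<le> c / lam * sqrt \<delta> * \<kappa>"
    using A.kappa(1) by (rule mult_right_mono)
  ultimately show ?thesis by (simp add: A_def algebra_simps)
qed

lemma svm_dist_kernel:
  assumes 1: "regularized_risk S k1 H1 ip1 R c lam \<kappa>" and 2: "regularized_risk S k2 H2 ip2 R c lam \<kappa>"
    and ne: "S \<noteq> {}"
    and m1: "reg_min H1 ip1 R lam f1" and m2: "reg_min H2 ip2 R lam f2"
    and lip: "\<And>f g e. f \<in> H1 \<Longrightarrow> g \<in> H2 \<Longrightarrow> (\<And>x. x \<in> S \<Longrightarrow> \<bar>f x - g x\<bar> \<le> e) \<Longrightarrow> 0 \<le> e \<Longrightarrow>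
      \<bar>R f - R g\<bar> \<le> c * e"
    and d: "\<And>x y. x \<in> S \<Longrightarrow> y \<in> S \<Longrightarrow> \<bar>k1 x y - k2 x y\<bar> \<le> \<delta>"
    and x: "x \<in> S"
  shows "\<bar>f1 x - f2 x\<bar> \<le> c / lam * (1 / 2 * \<delta> + \<kappa> * sqrt \<delta>)"
proof (cases "reg_obj ip1 R lam f1 \<le> reg_obj ip2 R lam f2")
  case True
  show ?thesis by (rule svm_dist_kernel_asym[OF 1 2 ne m1 m2 lip d True x])
next
  case False
  have "\<bar>f2 x - f1 x\<bar> \<le> c / lam * (1 / 2 * \<delta> + \<kappa> * sqrt \<delta>)"
  proof (rule svm_dist_kernel_asym[OF 2 1 ne m2 m1 _ _ _ x])
    show "\<bar>R f - R g\<bar> \<le> c * e"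
      if "f \<in> H2" "g \<in> H1" "\<And>x. x \<in> S \<Longrightarrow> \<bar>f x - g x\<bar> \<le> e" "0 \<le> e" for f g e
      using lip[OF that(2,1), of e] that(3,4) by (simp add: abs_minus_commute)
  qed (use False d in \<open>auto simp: abs_minus_commute\<close>)
  then show ?thesis by (simp add: abs_minus_commute)
qed

section \<open>Total variation\<close>

lemma sum_measure_partition:
  assumes "prob_space M" "\<And>i. i < n \<Longrightarrow> E i \<in> sets M" "disjoint_family_on E {..<n}" "(\<Union>i<n. E i) = space M"
  shows "(\<Sum>i<(n::nat). measure M (E i)) = 1"
proof -
  interpret prob_space M by fact
  show ?thesis
    using finite_measure_finite_Union[of "{..<n}" E] assms prob_space by auto
qed

text \<open>A supremum of reals dominates its members only if the set is bounded; here each sum is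
  at most the total mass of both measures, which is 2.\<close>

lemma tv_diff_upper:
  assumes P: "prob_space P" and Q: "prob_space Q" and s: "sets Q = sets P"
    and E: "\<And>i. i < n \<Longrightarrow> E i \<in> sets P" "disjoint_family_on E {..<n}" "(\<Union>i<n. E i) = space P"
  shows "(\<Sum>i<(n::nat). \<bar>measure P (E i) - measure Q (E i)\<bar>) \<le> tv_diff P Q"
  unfolding tv_diff_def tv_norm_def
proof (rule cSup_upper)
  show "bdd_above {(\<Sum>i<n. \<bar>measure P (E i) - measure Q (E i)\<bar>) | (n::nat) E.
     (\<forall>i<n. E i \<in> sets P) \<and> disjoint_family_on E {..<n} \<and> (\<Union>i<n. E i) = space P}"
  proof (rule bdd_aboveI[of _ 2], safe)
    fix n :: nat and E
    assume *: "\<forall>i<n. E i \<in> sets P" "disjoint_family_on E {..<n}" "(\<Union>i<n. E i) = space P"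
    have "(\<Sum>i<n. \<bar>measure P (E i) - measure Q (E i)\<bar>) \<le> (\<Sum>i<n. measure P (E i) + measure Q (E i))"
      by (intro sum_mono) (auto simp: abs_le_iff add_increasing add_increasing2)
    also have "\<dots> = 1 + 1"
      unfolding sum.distrib
      using sum_measure_partition[OF P, of n E] sum_measure_partition[OF Q, of n E] * s
        sets_eq_imp_space_eq[OF s] by simp
    finally show "(\<Sum>i<n. \<bar>measure P (E i) - measure Q (E i)\<bar>) \<le> 2" by simp
  qed
qed (use E in blast)

lemma tv_diff_nonneg:
  assumes P: "prob_space P" and Q: "prob_space Q" and s: "sets Q = sets P"
  shows "0 \<le> tv_diff P Q"
proof -
  have "(\<Sum>i<(1::nat). \<bar>measure P (space P) - measure Q (space P)\<bar>) \<le> tv_diff P Q"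
    by (rule tv_diff_upper[OF P Q s]) (auto simp: disjoint_family_on_def)
  then show ?thesis by (simp add: order_trans[OF abs_ge_zero])
qed

text \<open>The norm is defined by finite partitions, so \<open>\<phi>\<close> is rounded down to a
  grid of mesh \<open>e N\<close>, whose level sets form such a partition. Rounding costs at most
  \<open>e N\<close> for each measure, and the mesh tends to 0.\<close>

lemma integral_diff_le_tv:
  fixes \<phi> :: "'b \<Rightarrow> real"
  assumes P: "prob_space P" and Q: "prob_space Q" and s: "sets Q = sets P"
    and m: "\<phi> \<in> borel_measurable P" and b: "\<And>z. z \<in> space P \<Longrightarrow> \<bar>\<phi> z\<bar> \<le> M" and M: "0 \<le> M"
  shows "\<bar>(LINT z|P. \<phi> z) - (LINT z|Q. \<phi> z)\<bar> \<le> M * tv_diff P Q"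
proof -
  define e :: "nat \<Rightarrow> real" where "e N = 1 / (real N + 1)" for N
  have main: "\<bar>(LINT z|P. \<phi> z) - (LINT z|Q. \<phi> z)\<bar> \<le> 2 * e N + (M + e N) * tv_diff P Q" for N
  proof -
    have e: "0 < e N" by (simp add: e_def)
    define F where "F z = \<lfloor>\<phi> z / e N\<rfloor>" for z
    define K where "K = nat \<lceil>M / e N\<rceil> + 1"
    \<comment> \<open>The rounded values are \<open>e N * j\<close> with \<open>j\<close> between
      \<open>-K\<close> and \<open>K\<close>; index \<open>i\<close> stands for
      \<open>j = i - K\<close>, which gives \<open>2 * K + 1\<close> level sets.\<close>
    define E where "E i = {z \<in> space P. F z = int i - int K}" for i
    define a where "a i = e N * (real i - real K)" for i
    define n where "n = 2 * K + 1"
    have F: "e N * F z \<le> \<phi> z" "\<phi> z < e N * F z + e N" for z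
    proof -
      have "of_int (F z) \<le> \<phi> z / e N" "\<phi> z / e N < of_int (F z) + 1"
        unfolding F_def by linarith+
      then show "e N * F z \<le> \<phi> z" "\<phi> z < e N * F z + e N"
        using e by (simp_all add: pos_le_divide_eq pos_divide_less_eq distrib_left mult.commute)
    qed
    have Fr: "- int K \<le> F z" "F z \<le> int K" if z: "z \<in> space P" for z
    proof -
      have "- (M / e N) \<le> \<phi> z / e N" "\<phi> z / e N \<le> M / e N"
        using b[OF z] e by (auto simp: abs_le_iff field_simps)
      moreover have "M / e N \<le> real_of_int (int (nat \<lceil>M / e N\<rceil>))" by linarith
      ultimately show "- int K \<le> F z" "F z \<le> int K"
        unfolding F_def K_def by linarith+
    qed
    have Em: "E i \<in> sets P" for i
    proof -
      have "F \<in> measurable P (count_space UNIV)" unfolding F_def using m by measurable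
      from measurable_sets[OF this, of "{int i - int K}"] show ?thesis
        by (simp add: E_def vimage_def Int_def conj_commute)
    qed
    have Ed: "disjoint_family_on E {..<n}" by (auto simp: disjoint_family_on_def E_def)
    have Eu: "(\<Union>i<n. E i) = space P"
    proof
      show "space P \<subseteq> (\<Union>i<n. E i)"
      proof
        fix z assume z: "z \<in> space P"
        then have "z \<in> E (nat (F z + int K))" "nat (F z + int K) < n"
          using Fr[OF z] by (auto simp: E_def n_def)
        then show "z \<in> (\<Union>i<n. E i)" by blast
      qed
    qed (auto simp: E_def)
    define \<psi> where "\<psi> z = (\<Sum>i<n. a i * indicator (E i) z)" for z
    have psi: "\<psi> z = e N * F z" if z: "z \<in> space P" for z
    proof -
      let ?i = "nat (F z + int K)"
      have "indicator (E i) z = (if i = ?i then 1 else (0::real))" if "i < n" for i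
        using z Fr[OF z] by (auto simp: E_def indicator_def)
      then have "\<psi> z = (\<Sum>i<n. if i = ?i then a i else 0)"
        unfolding \<psi>_def by (intro sum.cong) auto
      also have "\<dots> = a ?i"
      proof -
        have "?i < n" using Fr[OF z] unfolding n_def by linarith
        then show ?thesis by simp
      qed
      also have "\<dots> = e N * F z" using Fr[OF z] by (simp add: a_def)
      finally show ?thesis .
    qed
    have int: "\<bar>(LINT z|R. \<phi> z) - (\<Sum>i<n. a i * measure R (E i))\<bar> \<le> e N"
      if R: "prob_space R" "sets R = sets P" for R
    proof -
      interpret R: prob_space R by (rule R)
      have spR: "space R = space P" using R(2) by (rule sets_eq_imp_space_eq)
      have mR: "\<phi> \<in> borel_measurable R" using m R(2) by (simp cong: measurable_cong_sets)
      have i1: "integrable R \<phi>"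
        using b spR mR by (intro R.integrable_const_bound[of _ M]) auto
      have i2: "integrable R (\<lambda>z. a i * indicator (E i) z)" for i
        using Em R(2) R.emeasure_finite[of "E i"]
        by (intro integrable_mult_right integrable_real_indicator) (auto simp: less_top[symmetric])
      have i3: "integrable R \<psi>" unfolding \<psi>_def by (intro Bochner_Integration.integrable_sum i2)
      have "(LINT z|R. \<psi> z) = (\<Sum>i<n. a i * measure R (E i))"
        unfolding \<psi>_def using Em R(2) sets.sets_into_space[OF Em]
        by (subst Bochner_Integration.integral_sum[OF i2]) (auto simp: spR Int_absorb2)
      then have "\<bar>(LINT z|R. \<phi> z) - (\<Sum>i<n. a i * measure R (E i))\<bar> = \<bar>LINT z|R. \<phi> z - \<psi> z\<bar>"
        using i1 i3 by simp
      also have "\<dots> \<le> (LINT z|R. \<bar>\<phi> z - \<psi> z\<bar>)" by (rule integral_abs_bound)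
      also have "\<dots> \<le> (LINT z|R. e N)"
        using i1 i3 F psi spR by (intro integral_mono) (auto simp: abs_le_iff diff_le_eq less_imp_le add.commute)
      also have "\<dots> = e N" by (simp add: R.prob_space)
      finally show ?thesis .
    qed
    have "\<bar>(\<Sum>i<n. a i * measure P (E i)) - (\<Sum>i<n. a i * measure Q (E i))\<bar>
       = \<bar>\<Sum>i<n. a i * (measure P (E i) - measure Q (E i))\<bar>"
      by (simp add: sum_subtractf right_diff_distrib)
    also have "\<dots> \<le> (\<Sum>i<n. \<bar>a i * (measure P (E i) - measure Q (E i))\<bar>)" by (rule sum_abs)
    also have "\<dots> \<le> (\<Sum>i<n. (M + e N) * \<bar>measure P (E i) - measure Q (E i)\<bar>)"
    proof (rule sum_mono)
      fix i
      show "\<bar>a i * (measure P (E i) - measure Q (E i))\<bar> \<le> (M + e N) * \<bar>measure P (E i) - measure Q (E i)\<bar>"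
      \<comment> \<open>Empty level sets have measure 0. On a nonempty one \<open>a i\<close> is a
        rounded value of \<open>\<phi>\<close>, hence at most \<open>M + e N\<close> in absolute
        value.\<close>
      proof (cases "E i = {}")
        case False
        then obtain z where z: "z \<in> space P" "F z = int i - int K" by (auto simp: E_def)
        then have "a i = e N * F z" by (simp add: a_def)
        then have "\<bar>a i\<bar> \<le> M + e N" using F[of z] b[OF z(1)] e by linarith
        then show ?thesis by (simp add: abs_mult mult_right_mono)
      qed simp
    qed
    also have "\<dots> \<le> (M + e N) * tv_diff P Q"
      using tv_diff_upper[OF P Q s Em Ed Eu] M e
      by (simp add: sum_distrib_left[symmetric] mult_left_mono)
    finally show ?thesis
      using int[OF P refl] int[OF Q s] by linarith
  qed
  have "e \<longlonglongrightarrow> 0" unfolding e_def by real_asymp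
  then have "(\<lambda>N. 2 * e N + (M + e N) * tv_diff P Q) \<longlonglongrightarrow> 2 * 0 + (M + 0) * tv_diff P Q"
    by (intro tendsto_intros)
  then have "\<bar>(LINT z|P. \<phi> z) - (LINT z|Q. \<phi> z)\<bar> \<le> 2 * 0 + (M + 0) * tv_diff P Q"
    by (rule LIMSEQ_le_const) (use main in auto)
  then show ?thesis by simp
qed

section \<open>Shifted losses\<close>

definition risk :: "('a \<Rightarrow> real \<Rightarrow> real \<Rightarrow> real) \<Rightarrow> ('a \<times> real) measure \<Rightarrow> ('a \<Rightarrow> real) \<Rightarrow> real" where
  "risk L Q f = (LINT z|Q. shifted_loss L (fst z) (snd z) (f (fst z)))"

locale risk_setting =
  fixes S :: "'a::polish_space set" and Y :: "real set" and L :: "'a \<Rightarrow> real \<Rightarrow> real \<Rightarrow> real"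
    and c :: real
  assumes loss: "loss_function Y L" and convex: "convex_loss Y L"
    and lipschitz: "is_lipschitz_const Y L c"
begin

definition is_dist :: "('a \<times> real) measure \<Rightarrow> bool" where
  "is_dist Q \<longleftrightarrow> prob_space Q \<and> sets Q = sets (restrict_space borel (S \<times> Y))"

definition admissible :: "('a \<Rightarrow> real) \<Rightarrow> bool" where
  "admissible f \<longleftrightarrow> f \<in> borel_measurable (restrict_space borel S) \<and> (\<exists>b. \<forall>x\<in>S. \<bar>f x\<bar> \<le> b)"

lemma space_dist: "is_dist Q \<Longrightarrow> space Q = S \<times> Y"
  unfolding is_dist_def using sets_eq_imp_space_eq[of Q "restrict_space borel (S \<times> Y)"]
  by (simp add: space_restrict_space)

lemma mem_space_dist:
  assumes "is_dist Q" "z \<in> space Q"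
  shows "fst z \<in> S" "snd z \<in> Y"
  using assms(2) unfolding space_dist[OF assms(1)] by (simp_all add: mem_Times_iff)

lemma c_nonneg: "0 \<le> c"
  using lipschitz by (simp add: is_lipschitz_const_def)

lemma loss_diff_le:
  assumes "y \<in> Y" "\<bar>s - t\<bar> \<le> e"
  shows "\<bar>shifted_loss L x y s - shifted_loss L x y t\<bar> \<le> c * e"
proof -
  have "\<bar>L x y s - L x y t\<bar> \<le> c * \<bar>s - t\<bar>"
    using lipschitz assms by (simp add: is_lipschitz_const_def)
  also have "\<dots> \<le> c * e" using assms c_nonneg by (intro mult_left_mono)
  finally show ?thesis by (simp add: shifted_loss_def)
qed

lemma loss_measurable:
  assumes Q: "is_dist Q" and f: "f \<in> borel_measurable (restrict_space borel S)"
  shows "(\<lambda>z. shifted_loss L (fst z) (snd z) (f (fst z))) \<in> borel_measurable Q"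
proof -
  let ?N = "restrict_space borel (S \<times> Y) :: ('a \<times> real) measure"
  have fst: "fst \<in> measurable ?N (restrict_space borel S)"
    by (intro measurable_restrict_space2 measurable_restrict_space1 borel_measurable_continuous_onI
        continuous_intros) (auto simp: space_restrict_space)
  have fst': "fst \<in> measurable ?N borel" and snd': "snd \<in> measurable ?N borel"
    by (intro measurable_restrict_space1 borel_measurable_continuous_onI continuous_intros)+
  have ff: "(\<lambda>z. f (fst z)) \<in> borel_measurable ?N" using measurable_compose[OF fst f] .
  have L: "(\<lambda>(x, y, t). L x y t) \<in> borel_measurable (restrict_space borel (UNIV \<times> Y \<times> UNIV))"
    using loss by (simp add: loss_function_def)
  have *: "(\<lambda>z. L (fst z) (snd z) (h z)) \<in> borel_measurable ?N" if h: "h \<in> borel_measurable ?N" for h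
  proof -
    have "(\<lambda>z. (fst z, snd z, h z)) \<in> measurable ?N (restrict_space borel (UNIV \<times> Y \<times> UNIV))"
      by (intro measurable_restrict_space2 borel_measurable_Pair fst' snd' h) (auto simp: space_restrict_space)
    from measurable_compose[OF this L] show ?thesis by simp
  qed
  have "(\<lambda>z. shifted_loss L (fst z) (snd z) (f (fst z))) \<in> borel_measurable ?N"
    unfolding shifted_loss_def by (intro borel_measurable_diff * ff) auto
  then show ?thesis using Q by (simp add: is_dist_def cong: measurable_cong_sets)
qed

text \<open>The shift is decisive: \<open>L\<close> itself may fail to be integrable, but the
  shifted loss vanishes at 0 and is therefore bounded by \<open>c\<close> times a bound of
  \<open>f\<close>.\<close>

lemma loss_integrable:
  assumes Q: "is_dist Q" and f: "admissible f"
  shows "integrable Q (\<lambda>z. shifted_loss L (fst z) (snd z) (f (fst z)))"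
proof -
  interpret prob_space Q using Q by (simp add: is_dist_def)
  obtain b where b: "\<And>x. x \<in> S \<Longrightarrow> \<bar>f x\<bar> \<le> b" using f by (auto simp: admissible_def)
  show ?thesis
  proof (rule integrable_const_bound[of _ "c * b"])
    show "AE z in Q. norm (shifted_loss L (fst z) (snd z) (f (fst z))) \<le> c * b"
    proof (rule AE_I2)
      fix z assume "z \<in> space Q"
      note z = mem_space_dist[OF Q this]
      show "norm (shifted_loss L (fst z) (snd z) (f (fst z))) \<le> c * b"
        using loss_diff_le[of "snd z" "f (fst z)" 0 b "fst z"] b z by (simp add: shifted_loss_def)
    qed
  qed (use loss_measurable[OF Q] f in \<open>auto simp: admissible_def\<close>)
qed

lemma risk_diff:
  assumes "is_dist Q" "admissible f" "admissible g"
  shows "risk L Q f - risk L Q g = (LINT z|Q. shifted_loss L (fst z) (snd z) (f (fst z))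
     - shifted_loss L (fst z) (snd z) (g (fst z)))"
  unfolding risk_def using assms by (simp add: loss_integrable)

lemma risk_lipschitz:
  assumes Q: "is_dist Q" and fg: "admissible f" "admissible g"
    and e: "\<And>x. x \<in> S \<Longrightarrow> \<bar>f x - g x\<bar> \<le> e"
  shows "\<bar>risk L Q f - risk L Q g\<bar> \<le> c * e"
proof -
  interpret prob_space Q using Q by (simp add: is_dist_def)
  have "\<bar>risk L Q f - risk L Q g\<bar> \<le> (LINT z|Q. \<bar>shifted_loss L (fst z) (snd z) (f (fst z))
     - shifted_loss L (fst z) (snd z) (g (fst z))\<bar>)"
    unfolding risk_diff[OF assms(1-3)] by (rule integral_abs_bound)
  also have "\<dots> \<le> (LINT z|Q. c * e)"
    using loss_integrable[OF Q fg(1)] loss_integrable[OF Q fg(2)]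
    by (intro integral_mono loss_diff_le e mem_space_dist[OF Q]) auto
  finally show ?thesis by (simp add: prob_space)
qed

text \<open>Both increments integrate the same function, which is bounded by \<open>c * e\<close>.
  This supplies the increment hypothesis of \<open>svm_dist_risk\<close> with
  \<open>tv_diff Q1 Q2\<close> as its \<open>T\<close>.\<close>

lemma risk_diff_tv:
  assumes Q: "is_dist Q1" "is_dist Q2" and fg: "admissible f" "admissible g"
    and e: "\<And>x. x \<in> S \<Longrightarrow> \<bar>f x - g x\<bar> \<le> e" "0 \<le> e"
  shows "\<bar>(risk L Q1 f - risk L Q1 g) - (risk L Q2 f - risk L Q2 g)\<bar> \<le> c * e * tv_diff Q1 Q2"
  unfolding risk_diff[OF Q(1) fg] risk_diff[OF Q(2) fg]
proof (rule integral_diff_le_tv)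
  show "prob_space Q1" "prob_space Q2" "sets Q2 = sets Q1" using Q by (auto simp: is_dist_def)
  show "(\<lambda>z. shifted_loss L (fst z) (snd z) (f (fst z)) - shifted_loss L (fst z) (snd z) (g (fst z)))
      \<in> borel_measurable Q1"
    using fg loss_measurable[OF Q(1)] by (auto simp: admissible_def)
  show "\<bar>shifted_loss L (fst z) (snd z) (f (fst z)) - shifted_loss L (fst z) (snd z) (g (fst z))\<bar> \<le> c * e"
    if "z \<in> space Q1" for z
    by (intro loss_diff_le e mem_space_dist[OF Q(1) that])
  show "0 \<le> c * e" using c_nonneg e by simp
qed

lemma risk_convex:
  assumes Q: "is_dist Q" and fg: "admissible f" "admissible g" "admissible (lincomb S (1 - t) f t g)"
    and t: "0 \<le> t" "t \<le> 1"
  shows "risk L Q (lincomb S (1 - t) f t g) \<le> (1 - t) * risk L Q f + t * risk L Q g"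
proof -
  let ?l = "\<lambda>f z. shifted_loss L (fst z) (snd z) (f (fst z))"
  note i = loss_integrable[OF Q fg(1)] loss_integrable[OF Q fg(2)] loss_integrable[OF Q fg(3)]
  have "risk L Q (lincomb S (1 - t) f t g) \<le> (LINT z|Q. (1 - t) * ?l f z + t * ?l g z)"
    unfolding risk_def
  proof (rule integral_mono)
    fix z assume "z \<in> space Q"
    note z = mem_space_dist[OF Q this]
    have "convex_on UNIV (L (fst z) (snd z))" using z convex by (simp add: convex_loss_def)
    from convex_onD[OF this t, of "f (fst z)" "g (fst z)"]
    show "?l (lincomb S (1 - t) f t g) z \<le> (1 - t) * ?l f z + t * ?l g z"
      using z by (simp add: shifted_loss_def algebra_simps)
  qed (use i in auto)
  also have "\<dots> = (1 - t) * risk L Q f + t * risk L Q g"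
    unfolding risk_def using i by simp
  finally show ?thesis .
qed

section \<open>Local SVMs as minimizers of a regularized risk\<close>

lemma rkhs_admissible:
  assumes r: "rkhs S k H ip" and k: "measurable_kernel S k"
    and kappa: "0 \<le> \<kappa>" "\<forall>x\<in>S. sqrt (k x x) \<le> \<kappa>" and f: "f \<in> H"
  shows "admissible f"
proof -
  interpret rkhs S k H ip by (rule r)
  have sec: "ksec x \<in> borel_measurable (restrict_space borel S)" if x: "x \<in> S" for x
  proof -
    have "(\<lambda>x'. (x', x)) \<in> measurable (restrict_space borel S) (restrict_space borel (S \<times> S))"
      using x by (intro measurable_restrict_space2 measurable_restrict_space1
          borel_measurable_continuous_onI continuous_intros) (auto simp: space_restrict_space)
    from measurable_compose[OF this k[unfolded measurable_kernel_def]]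
    show ?thesis by (subst measurable_cong[where g = "\<lambda>x'. k x' x"]) (auto simp: space_restrict_space)
  qed
  have "\<bar>f x\<bar> \<le> fs_norm ip f * \<kappa>" if "x \<in> S" for x
    using eval_bound[OF f that] mult_left_mono[OF bspec[OF kappa(2) that] fs_norm_nonneg[OF f]] by linarith
  then show ?thesis
    unfolding admissible_def
    using measurable_member[OF _ sec f] by (auto simp: space_restrict_space)
qed

lemma regularized_risk_svm:
  assumes r: "rkhs S k H ip" and k: "measurable_kernel S k"
    and kappa: "0 \<le> \<kappa>" "\<forall>x\<in>S. sqrt (k x x) \<le> \<kappa>"
    and Q: "is_dist Q" and lam: "0 < lam"
  shows "regularized_risk S k H ip (risk L Q) c lam \<kappa>"
proof -
  interpret rkhs S k H ip by (rule r)
  note ad = rkhs_admissible[OF r k kappa]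
  show ?thesis
    using lam c_nonneg kappa ad risk_convex[OF Q] risk_lipschitz[OF Q]
    by unfold_locales auto
qed

text \<open>The intermediate minimizers \<open>g\<close> and \<open>h\<close> both live in
  \<open>H1\<close>: the measure is exchanged at \<open>l1\<close>, then the parameter, and only the
  last exchange, at \<open>l2\<close>, changes the space.\<close>

lemma svm_dist:
  assumes r: "rkhs S k1 H1 ip1" "rkhs S k2 H2 ip2"
    and k: "measurable_kernel S k1" "measurable_kernel S k2"
    and kappa: "0 \<le> \<kappa>" "\<forall>x\<in>S. sqrt (k1 x x) \<le> \<kappa>" "\<forall>x\<in>S. sqrt (k2 x x) \<le> \<kappa>"
    and Q: "is_dist Q1" "is_dist Q2"
    and tau: "0 < \<tau>" "\<tau> \<le> l1" "\<tau> \<le> l2"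
    and delta: "\<And>x y. x \<in> S \<Longrightarrow> y \<in> S \<Longrightarrow> \<bar>k1 x y - k2 x y\<bar> \<le> \<delta>"
    and m: "reg_min H1 ip1 (risk L Q1) l1 f1" "reg_min H2 ip2 (risk L Q2) l2 f2"
    and x: "x \<in> S"
  shows "\<bar>f1 x - f2 x\<bar> \<le> c * (1 / \<tau> * (\<kappa>\<^sup>2 * tv_diff Q1 Q2 + \<kappa>\<^sup>2 / \<tau> * \<bar>l1 - l2\<bar>
     + 1 / 2 * \<delta> + \<kappa> * sqrt \<delta>))"
proof -
  have l: "0 < l1" "0 < l2" using tau by auto
  note rr1 = regularized_risk_svm[OF r(1) k(1) kappa(1,2)]
  note rr2 = regularized_risk_svm[OF r(2) k(2) kappa(1,3)]
  note ad1 = rkhs_admissible[OF r(1) k(1) kappa(1,2)]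
  note ad2 = rkhs_admissible[OF r(2) k(2) kappa(1,3)]
  obtain g where g: "reg_min H1 ip1 (risk L Q2) l1 g"
    using regularized_risk.exists_min[OF rr1[OF Q(2) l(1)]] by blast
  obtain h where h: "reg_min H1 ip1 (risk L Q2) l2 h"
    using regularized_risk.exists_min[OF rr1[OF Q(2) l(2)]] by blast
  have tv: "0 \<le> tv_diff Q1 Q2"
    using Q by (intro tv_diff_nonneg) (auto simp: is_dist_def)
  have d0: "0 \<le> \<delta>" using delta[OF x x] by linarith
  \<comment> \<open>Each exchange has the parameter at which it is made in its denominator; passing
    to the smaller \<open>\<tau>\<close> only enlarges the bound.\<close>
  have mono: "c / l * z \<le> c / \<tau> * z" if "0 \<le> z" "\<tau> \<le> l" for l z
    using that tau c_nonneg by (intro mult_right_mono divide_left_mono) auto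
  have "\<bar>f1 x - g x\<bar> \<le> c * \<kappa>\<^sup>2 / l1 * tv_diff Q1 Q2"
  proof (rule svm_dist_risk[OF rr1[OF Q(1) l(1)] rr1[OF Q(2) l(1)] m(1) g tv _ x])
    show "\<bar>(risk L Q1 f - risk L Q1 g) - (risk L Q2 f - risk L Q2 g)\<bar> \<le> c * e * tv_diff Q1 Q2"
      if "f \<in> H1" "g \<in> H1" "\<And>x. x \<in> S \<Longrightarrow> \<bar>f x - g x\<bar> \<le> e" "0 \<le> e" for f g e
      by (rule risk_diff_tv[OF Q ad1[OF that(1)] ad1[OF that(2)] that(3,4)])
  qed
  then have 1: "\<bar>f1 x - g x\<bar> \<le> c / \<tau> * (\<kappa>\<^sup>2 * tv_diff Q1 Q2)"
    using mono[of "\<kappa>\<^sup>2 * tv_diff Q1 Q2" l1] tv tau by simp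
  have "\<bar>g x - h x\<bar> \<le> c * \<kappa>\<^sup>2 / \<tau>\<^sup>2 * \<bar>l1 - l2\<bar>"
    by (rule svm_dist_regularization[OF rr1[OF Q(2) l(1)] rr1[OF Q(2) l(2)] g h tau x])
  then have 2: "\<bar>g x - h x\<bar> \<le> c / \<tau> * (\<kappa>\<^sup>2 / \<tau> * \<bar>l1 - l2\<bar>)"
    by (simp add: power2_eq_square)
  have "\<bar>h x - f2 x\<bar> \<le> c / l2 * (1 / 2 * \<delta> + \<kappa> * sqrt \<delta>)"
    using x by (intro svm_dist_kernel[OF rr1[OF Q(2) l(2)] rr2[OF Q(2) l(2)] _ h m(2)
          risk_lipschitz[OF Q(2) ad1 ad2] delta]) auto
  then have 3: "\<bar>h x - f2 x\<bar> \<le> c / \<tau> * (1 / 2 * \<delta> + \<kappa> * sqrt \<delta>)"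
    using mono[of "1 / 2 * \<delta> + \<kappa> * sqrt \<delta>" l2] d0 kappa(1) tau(3) by simp
  have "\<bar>f1 x - f2 x\<bar> \<le> \<bar>f1 x - g x\<bar> + \<bar>g x - h x\<bar> + \<bar>h x - f2 x\<bar>" by linarith
  also have "\<dots> \<le> c / \<tau> * (\<kappa>\<^sup>2 * tv_diff Q1 Q2) + c / \<tau> * (\<kappa>\<^sup>2 / \<tau> * \<bar>l1 - l2\<bar>)
      + c / \<tau> * (1 / 2 * \<delta> + \<kappa> * sqrt \<delta>)"
    by (intro add_mono 1 2 3)
  also have "\<dots> = c * (1 / \<tau> * (\<kappa>\<^sup>2 * tv_diff Q1 Q2 + \<kappa>\<^sup>2 / \<tau> * \<bar>l1 - l2\<bar>
     + 1 / 2 * \<delta> + \<kappa> * sqrt \<delta>))"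
    by (simp add: distrib_left add.assoc)
  finally show ?thesis .
qed

text \<open>\<open>svm\<close> is a Hilbert choice through \<open>arg_min_on\<close>; an existing
  minimizer guarantees that the chosen function is one.\<close>

lemma reg_min_svm:
  assumes rr: "regularized_risk S k H ip (risk L Q) c lam \<kappa>"
  shows "reg_min H ip (risk L Q) lam (svm L Q lam H ip)"
proof -
  interpret regularized_risk S k H ip "risk L Q" c lam \<kappa> by fact
  have eq: "svm_objective L Q lam ip f = obj f" if "f \<in> H" for f
    using that by (simp add: svm_objective_def reg_obj_def risk_def fs_norm_sq)
  obtain f where f: "is_min f" using exists_min by blast
  have "is_arg_min (svm_objective L Q lam ip) (\<lambda>x. x \<in> H) f"
    using f eq by (auto simp: is_arg_min_linorder reg_min_def)
  then have "is_arg_min (svm_objective L Q lam ip) (\<lambda>x. x \<in> H) (svm L Q lam H ip)"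
    unfolding svm_def arg_min_on_def arg_min_def
    by (rule someI[where P = "is_arg_min (svm_objective L Q lam ip) (\<lambda>x. x \<in> H)"])
  then have "svm L Q lam H ip \<in> H"
    "\<And>g. g \<in> H \<Longrightarrow> svm_objective L Q lam ip (svm L Q lam H ip) \<le> svm_objective L Q lam ip g"
    unfolding is_arg_min_linorder by blast+
  then show ?thesis unfolding reg_min_def by (metis eq)
qed

lemma is_dist_local_measure:
  assumes P: "prob_space P" and sP: "sets P = sets (restrict_space borel (UNIV \<times> Y))"
    and Y: "closed Y" and S: "S \<in> sets borel" and pos: "emeasure P (S \<times> Y) > 0"
  shows "is_dist (local_measure P S Y)"
proof -
  interpret P: prob_space P by fact
  have Yb: "Y \<in> sets borel" using Y by simp
  have SY: "S \<times> Y \<in> sets P"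
  proof -
    \<comment> \<open>Rectangles lie in the product sigma-algebra, which is the Borel one because
      both factors are second countable.\<close>
    have "S \<times> Y \<in> sets (borel \<Otimes>\<^sub>M borel :: ('a \<times> real) measure)"
      "UNIV \<times> Y \<in> sets (borel \<Otimes>\<^sub>M borel :: ('a \<times> real) measure)"
      using S Yb by auto
    then have "S \<times> Y \<in> sets borel" "UNIV \<times> Y \<in> sets (borel :: ('a \<times> real) measure)"
      unfolding borel_prod by auto
    then show ?thesis unfolding sP by (subst sets_restrict_space_iff) auto
  qed
  have sets: "sets (local_measure P S Y) = sets (restrict_space borel (S \<times> Y))"
  proof -
    have "sets (restrict_space P (S \<times> Y)) = sets (restrict_space (restrict_space borel (UNIV \<times> Y)) (S \<times> Y))"
      by (rule sets_restrict_space_cong[OF sP])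
    also have "\<dots> = sets (restrict_space borel (S \<times> Y))"
    proof -
      have "(UNIV \<times> Y) \<inter> (S \<times> Y) = S \<times> Y" by auto
      then show ?thesis by (simp add: sets_restrict_restrict_space)
    qed
    finally show ?thesis by (simp add: local_measure_def)
  qed
  let ?p = "emeasure P (S \<times> Y)"
  have "emeasure (local_measure P S Y) (space (local_measure P S Y)) = 1 / ?p * ?p"
    using SY sets.sets_into_space[OF SY]
    by (simp add: local_measure_def space_scale_measure space_restrict_space emeasure_restrict_space Int_absorb2)
  \<comment> \<open>The quotient cancels in \<open>ennreal\<close> because the mass is positive by
    \<open>pos\<close> and finite under a probability measure.\<close>
  also have "\<dots> = 1"
    using pos P.emeasure_finite[of "S \<times> Y"] ennreal_divide_self[of ?p]
    by (simp add: ennreal_divide_times less_top[symmetric])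
  finally show ?thesis using sets by (auto simp: is_dist_def intro: prob_spaceI)
qed

end

text \<open>\<open>LEAST\<close> on the reals is informative only if the infimum is attained. It is:
  every difference quotient is a lower bound of all Lipschitz constants, hence at most their
  infimum.\<close>

lemma is_lipschitz_const_loss_lip:
  assumes "lipschitz_loss Y L"
  shows "is_lipschitz_const Y L (loss_lip Y L)"
proof -
  let ?C = "{c. is_lipschitz_const Y L c}"
  have ne: "?C \<noteq> {}" using assms by (simp add: lipschitz_loss_def)
  have bdd: "bdd_below ?C" by (rule bdd_belowI[of _ 0]) (simp add: is_lipschitz_const_def)
  have inf: "is_lipschitz_const Y L (Inf ?C)"
    unfolding is_lipschitz_const_def[of Y L "Inf ?C"]
  proof (intro conjI allI ballI)
    show "0 \<le> Inf ?C" using ne by (intro cInf_greatest) (auto simp: is_lipschitz_const_def)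
    fix x y t1 t2 assume y: "y \<in> Y"
    show "\<bar>L x y t1 - L x y t2\<bar> \<le> Inf ?C * \<bar>t1 - t2\<bar>"
    proof (cases "t1 = t2")
      case False
      have "\<bar>L x y t1 - L x y t2\<bar> / \<bar>t1 - t2\<bar> \<le> Inf ?C"
        using ne y False by (intro cInf_greatest) (auto simp: is_lipschitz_const_def pos_divide_le_eq)
      then show ?thesis using False by (simp add: pos_divide_le_eq)
    qed simp
  qed
  have "loss_lip Y L = Inf ?C"
    unfolding loss_lip_def using inf cInf_lower[OF _ bdd] by (intro Least_equality) auto
  then show ?thesis using inf by simp
qed

section \<open>Averaging the local bounds with the weights\<close>

theorem theorem3p1:
  fixes Y :: "real set"
    and P :: "nat \<Rightarrow> ('a::polish_space \<times> real) measure"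
    and B :: nat
    and X :: "nat \<Rightarrow> 'a set"
    and lam :: "nat \<Rightarrow> nat \<Rightarrow> real"
    and k :: "nat \<Rightarrow> nat \<Rightarrow> 'a \<Rightarrow> 'a \<Rightarrow> real"
    and H :: "nat \<Rightarrow> nat \<Rightarrow> ('a \<Rightarrow> real) set"
    and ip :: "nat \<Rightarrow> nat \<Rightarrow> ('a \<Rightarrow> real) \<Rightarrow> ('a \<Rightarrow> real) \<Rightarrow> real"
    and kappa tau :: "nat \<Rightarrow> real"
    and L :: "'a \<Rightarrow> real \<Rightarrow> real \<Rightarrow> real"
    and w :: "nat \<Rightarrow> 'a \<Rightarrow> real"
  assumes Y_closed: "closed Y"
    and P_sets: "\<And>i. i \<in> {1, 2} \<Longrightarrow> sets (P i) = sets (restrict_space borel (UNIV \<times> Y))"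
    and P_prob: "\<And>i. i \<in> {1, 2} \<Longrightarrow> prob_space (P i)"
    and X_borel: "\<And>b. b \<in> {1..B} \<Longrightarrow> X b \<in> sets borel"
    and X_cover: "(\<Union>b\<in>{1..B}. X b) = UNIV"
    and P_pos: "\<And>i b. \<lbrakk>i \<in> {1, 2}; b \<in> {1..B}\<rbrakk> \<Longrightarrow> emeasure (P i) (X b \<times> Y) > 0"
    and lam_pos: "\<And>i b. \<lbrakk>i \<in> {1, 2}; b \<in> {1..B}\<rbrakk> \<Longrightarrow> lam i b > 0"
    and k_kernel: "\<And>i b. \<lbrakk>i \<in> {1, 2}; b \<in> {1..B}\<rbrakk> \<Longrightarrow> is_kernel (X b) (k i b)"
    and k_bounded: "\<And>i b. \<lbrakk>i \<in> {1, 2}; b \<in> {1..B}\<rbrakk> \<Longrightarrow> bounded_kernel (X b) (k i b)"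
    and k_measurable: "\<And>i b. \<lbrakk>i \<in> {1, 2}; b \<in> {1..B}\<rbrakk> \<Longrightarrow> measurable_kernel (X b) (k i b)"
    and H_rkhs: "\<And>i b. \<lbrakk>i \<in> {1, 2}; b \<in> {1..B}\<rbrakk> \<Longrightarrow> rkhs (X b) (k i b) (H i b) (ip i b)"
    and H_separable: "\<And>i b. \<lbrakk>i \<in> {1, 2}; b \<in> {1..B}\<rbrakk> \<Longrightarrow> separable_fs (X b) (H i b) (ip i b)"
    and kappa_eq: "\<And>b. b \<in> {1..B} \<Longrightarrow>
          kappa b = max (kernel_sup (X b) (k 1 b)) (kernel_sup (X b) (k 2 b))"
    and tau_eq: "\<And>b. b \<in> {1..B} \<Longrightarrow> tau b = min (lam 1 b) (lam 2 b)"
    and L_loss: "loss_function Y L"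
    and L_convex: "convex_loss Y L"
    and L_lipschitz: "lipschitz_loss Y L"
    and W1: "\<And>b x. b \<in> {1..B} \<Longrightarrow> w b x \<in> {0..1}"
    and W2: "\<And>x. (\<Sum>b=1..B. w b x) = 1"
    and W3: "\<And>b x. \<lbrakk>b \<in> {1..B}; x \<notin> X b\<rbrakk> \<Longrightarrow> w b x = 0"
  shows "sup_norm (\<lambda>x. localized_svm B w X Y L (P 1) (lam 1) (H 1) (ip 1) x
                     - localized_svm B w X Y L (P 2) (lam 2) (H 2) (ip 2) x)
    \<le> ereal (loss_lip Y L *
        (MAX b\<in>{1..B}. 1 / tau b *
          ((kappa b)\<^sup>2 * tv_diff (local_measure (P 1) (X b) Y) (local_measure (P 2) (X b) Y)
           + (kappa b)\<^sup>2 / tau b * \<bar>lam 1 b - lam 2 b\<bar>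
           + 1 / 2 * kernel_diff_sup (X b) (k 1 b) (k 2 b)
           + kappa b * sqrt (kernel_diff_sup (X b) (k 1 b) (k 2 b)))))"
proof -
  define c where "c = loss_lip Y L"
  define f where "f i b = svm L (local_measure (P i) (X b) Y) (lam i b) (H i b) (ip i b)" for i b
  define \<beta> where "\<beta> b = 1 / tau b *
          ((kappa b)\<^sup>2 * tv_diff (local_measure (P 1) (X b) Y) (local_measure (P 2) (X b) Y)
           + (kappa b)\<^sup>2 / tau b * \<bar>lam 1 b - lam 2 b\<bar>
           + 1 / 2 * kernel_diff_sup (X b) (k 1 b) (k 2 b)
           + kappa b * sqrt (kernel_diff_sup (X b) (k 1 b) (k 2 b)))" for b
  have lip: "is_lipschitz_const Y L c" unfolding c_def by (rule is_lipschitz_const_loss_lip[OF L_lipschitz])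
  have c0: "0 \<le> c" using lip by (simp add: is_lipschitz_const_def)
  have bound: "\<bar>f 1 b x - f 2 b x\<bar> \<le> c * \<beta> b" if b: "b \<in> {1..B}" and x: "x \<in> X b" for b x
  proof -
    interpret risk_setting "X b" Y L c using L_loss L_convex lip by unfold_locales
    have i: "1 \<in> {1, 2::nat}" "2 \<in> {1, 2::nat}" by auto
    interpret R1: rkhs "X b" "k 1 b" "H 1 b" "ip 1 b" by (rule H_rkhs[OF i(1) b])
    interpret R2: rkhs "X b" "k 2 b" "H 2 b" "ip 2 b" by (rule H_rkhs[OF i(2) b])
    have sup: "sqrt (k i b y y) \<le> kernel_sup (X b) (k i b)" if "i \<in> {1, 2}" "y \<in> X b" for i y
      unfolding kernel_sup_def using k_bounded[OF that(1) b] that(2)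
      by (intro cSUP_upper) (auto simp: bounded_kernel_def)
    have kap: "sqrt (k 1 b y y) \<le> kappa b" "sqrt (k 2 b y y) \<le> kappa b" if "y \<in> X b" for y
      using sup[OF i(1) that] sup[OF i(2) that] kappa_eq[OF b] by auto
    then have kapB: "\<forall>y\<in>X b. sqrt (k 1 b y y) \<le> kappa b" "\<forall>y\<in>X b. sqrt (k 2 b y y) \<le> kappa b"
      by auto
    have kap0: "0 \<le> kappa b" using kap(1)[OF x] R1.kernel_diag_nonneg[OF x] by (meson order_trans real_sqrt_ge_zero)
    have ab: "\<bar>k 1 b y z\<bar> \<le> kappa b * kappa b" "\<bar>k 2 b y z\<bar> \<le> kappa b * kappa b"
      if "y \<in> X b" "z \<in> X b" for y z
    proof -
      have "sqrt (k 1 b y y) * sqrt (k 1 b z z) \<le> kappa b * kappa b"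
        using kap that kap0 R1.kernel_diag_nonneg by (intro mult_mono) auto
      then show "\<bar>k 1 b y z\<bar> \<le> kappa b * kappa b" using R1.kernel_bound[OF that] by linarith
      have "sqrt (k 2 b y y) * sqrt (k 2 b z z) \<le> kappa b * kappa b"
        using kap that kap0 R2.kernel_diag_nonneg by (intro mult_mono) auto
      then show "\<bar>k 2 b y z\<bar> \<le> kappa b * kappa b" using R2.kernel_bound[OF that] by linarith
    qed
    \<comment> \<open>Cauchy-Schwarz carries the bound by \<open>kappa b * kappa b\<close> from the
      diagonal to all pairs, which makes the real supremum of the kernel difference a genuine upper
      bound.\<close>
    have bdd: "bdd_above ((\<lambda>(y, z). \<bar>k 1 b y z - k 2 b y z\<bar>) ` (X b \<times> X b))"
    proof (rule bdd_aboveI2[where M = "2 * (kappa b * kappa b)"])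
      fix p assume "p \<in> X b \<times> X b"
      then show "(case p of (y, z) \<Rightarrow> \<bar>k 1 b y z - k 2 b y z\<bar>) \<le> 2 * (kappa b * kappa b)"
        using ab[of "fst p" "snd p"] by (auto simp: split_beta)
    qed
    have del: "\<bar>k 1 b y z - k 2 b y z\<bar> \<le> kernel_diff_sup (X b) (k 1 b) (k 2 b)"
      if "y \<in> X b" "z \<in> X b" for y z
      unfolding kernel_diff_sup_def using cSUP_upper[OF _ bdd, of "(y, z)"] that by simp
    have dist: "is_dist (local_measure (P i) (X b) Y)" if "i \<in> {1, 2}" for i
      by (rule is_dist_local_measure[OF P_prob[OF that] P_sets[OF that] Y_closed X_borel[OF b] P_pos[OF that b]])
    note rr1 = regularized_risk_svm[OF R1.rkhs_axioms k_measurable[OF i(1) b] kap0 kapB(1) dist[OF i(1)] lam_pos[OF i(1) b]]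
    note rr2 = regularized_risk_svm[OF R2.rkhs_axioms k_measurable[OF i(2) b] kap0 kapB(2) dist[OF i(2)] lam_pos[OF i(2) b]]
    show ?thesis
      unfolding f_def \<beta>_def
    proof (rule svm_dist[OF R1.rkhs_axioms R2.rkhs_axioms k_measurable[OF i(1) b] k_measurable[OF i(2) b]
          kap0 kapB dist[OF i(1)] dist[OF i(2)]])
      show "0 < tau b" "tau b \<le> lam 1 b" "tau b \<le> lam 2 b"
        using tau_eq[OF b] lam_pos[OF i(1) b] lam_pos[OF i(2) b] by auto
    qed (use reg_min_svm[OF rr1] reg_min_svm[OF rr2] x del in auto)
  qed
  have "\<bar>localized_svm B w X Y L (P 1) (lam 1) (H 1) (ip 1) x
      - localized_svm B w X Y L (P 2) (lam 2) (H 2) (ip 2) x\<bar> \<le> c * (MAX b\<in>{1..B}. \<beta> b)" for x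
  proof -
    have "\<bar>localized_svm B w X Y L (P 1) (lam 1) (H 1) (ip 1) x
      - localized_svm B w X Y L (P 2) (lam 2) (H 2) (ip 2) x\<bar>
      = \<bar>\<Sum>b=1..B. w b x * (zero_ext (X b) (f 1 b) x - zero_ext (X b) (f 2 b) x)\<bar>"
      by (simp add: localized_svm_def f_def sum_subtractf right_diff_distrib)
    also have "\<dots> \<le> (\<Sum>b=1..B. \<bar>w b x * (zero_ext (X b) (f 1 b) x - zero_ext (X b) (f 2 b) x)\<bar>)"
      by (rule sum_abs)
    also have "\<dots> \<le> (\<Sum>b=1..B. w b x * (c * (MAX b\<in>{1..B}. \<beta> b)))"
    proof (rule sum_mono)
      fix b assume b: "b \<in> {1..B}"
      show "\<bar>w b x * (zero_ext (X b) (f 1 b) x - zero_ext (X b) (f 2 b) x)\<bar> \<le> w b x * (c * (MAX b\<in>{1..B}. \<beta> b))"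
      \<comment> \<open>The local bound holds only on \<open>X b\<close>; elsewhere the weight
        vanishes by \<open>W3\<close>.\<close>
      proof (cases "x \<in> X b")
        case True
        have "\<bar>f 1 b x - f 2 b x\<bar> \<le> c * \<beta> b" by (rule bound[OF b True])
        also have "\<dots> \<le> c * (MAX b\<in>{1..B}. \<beta> b)"
          using b c0 by (intro mult_left_mono Max_ge) auto
        finally show ?thesis using W1[OF b, of x] True by (simp add: zero_ext_def abs_mult mult_left_mono)
      qed (use W3[OF b] in simp)
    qed
    also have "\<dots> = c * (MAX b\<in>{1..B}. \<beta> b)"
      using W2[of x] by (simp add: sum_distrib_right[symmetric])
    finally show ?thesis .
  qed
  then show ?thesis
    unfolding sup_norm_def \<beta>_def[symmetric] c_def[symmetric] by (intro SUP_least) simp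
qed

end
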